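(* Let $r \ge 2$ be a fixed integer and let $H = (V,E)$ be a hypergraph with $m$ hyperedges and maximum vertex degree $k = o(\sqrt{m})$, where each hyperedge has size at most $r$. Then $H$ has a balanced separator of size at most $(\frac12 - \epsilon_r)m + o(m)$, where $\epsilon_r = (1 - 2^{-1/r})^r$. Furthermore, such a balanced separator can be found by a randomized algorithm in expected polynomial time, and by a deterministic algorithm in time $m^{O(1)} 2^{(1 - 2\epsilon_r^2)m + o(m)}$.
   Context: All hypergraphs are finite. The degree of a vertex is the number of hyperedges containing it. A connected component of a hypergraph $(V,E)$ is a maximal subset $S \subseteq V$ such that for every pair $u,v \in S$ there is a sequence of hyperedges $e_1,\dots,e_t$, each contained in $S$, with $u \in e_1$, $v \in e_t$ and $e_i \cap e_{i+1} \neq \emptyset$ for all $1 \le i \le t-1$ (a vertex lying in no hyperedge forms a component by itself). A balanced separator for $H=(V,E)$ is a set $R \subseteq E$ such that every connected component of $(V, E\setminus R)$ is incident to at most $|E|/2$ hyperedges of $E \setminus R$. Asymptotic notation is as $m \to \infty$ with $r$ fixed: for every fixed $r$ and every function $k(m) = o(\sqrt m)$ there is a function $g(m) = o(m)$ such that the statement holds, with $o(m)$ replaced by $g(m)$, for all hypergraphs with $m$ hyperedges of size at most $r$ and maximum degree at most $k(m)$. *)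

theory Defs
  imports "HOL-Probability.Probability" "HOL-Library.Landau_Symbols"
begin

section \<open>Hypergraphs and balanced separators\<close>

definition hypergraph :: "'a set \<Rightarrow> 'a set set \<Rightarrow> bool" where
  "hypergraph V E \<longleftrightarrow> finite V \<and> E \<subseteq> Pow V"

definition vdegree :: "'a set set \<Rightarrow> 'a \<Rightarrow> nat" where
  "vdegree E v = card {e \<in> E. v \<in> e}"

definition bounded_hypergraph :: "nat \<Rightarrow> real \<Rightarrow> 'a set \<Rightarrow> 'a set set \<Rightarrow> bool" where
  "bounded_hypergraph r d V E \<longleftrightarrow>
     hypergraph V E \<and> (\<forall>e\<in>E. card e \<le> r) \<and> (\<forall>v\<in>V. real (vdegree E v) \<le> d)"

definition edge_walk_in :: "'a set set \<Rightarrow> 'a set \<Rightarrow> 'a \<Rightarrow> 'a \<Rightarrow> 'a set list \<Rightarrow> bool" where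
  "edge_walk_in E S u v es \<longleftrightarrow>
     es \<noteq> [] \<and> set es \<subseteq> E \<and> (\<forall>e\<in>set es. e \<subseteq> S) \<and> u \<in> hd es \<and> v \<in> last es \<and>
     (\<forall>i. Suc i < length es \<longrightarrow> es ! i \<inter> es ! Suc i \<noteq> {})"

definition linked_set :: "'a set \<Rightarrow> 'a set set \<Rightarrow> 'a set \<Rightarrow> bool" where
  "linked_set V E S \<longleftrightarrow> S \<subseteq> V \<and> (\<forall>u\<in>S. \<forall>v\<in>S. \<exists>es. edge_walk_in E S u v es)"

text \<open>A vertex in no hyperedge is not even linked to itself, so it has to be made a component
  separately.\<close>

definition hyper_component :: "'a set \<Rightarrow> 'a set set \<Rightarrow> 'a set \<Rightarrow> bool" where
  "hyper_component V E S \<longleftrightarrow>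
     (S \<noteq> {} \<and> linked_set V E S \<and> (\<forall>T. linked_set V E T \<and> S \<subseteq> T \<longrightarrow> T = S)) \<or>
     (\<exists>v\<in>V. S = {v} \<and> (\<forall>e\<in>E. v \<notin> e))"

definition balanced_separator :: "'a set \<Rightarrow> 'a set set \<Rightarrow> 'a set set \<Rightarrow> bool" where
  "balanced_separator V E R \<longleftrightarrow> R \<subseteq> E \<and>
     (\<forall>S. hyper_component V (E - R) S \<longrightarrow>
        real (card {e \<in> E - R. e \<inter> S \<noteq> {}}) \<le> real (card E) / 2)"

definition eps :: "nat \<Rightarrow> real" where
  "eps r = (1 - 2 powr (- 1 / real r)) ^ r"

section \<open>Random access machine programs\<close>

text \<open>
  The machine model is the uniform-cost RAM with addition and truncated subtraction and a
  fair-coin instruction, presented as structured programs. The memory consists of finitely many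
  (as each program mentions finitely many names) named banks of cells holding natural numbers.
  Indices are computed values, so addressing is indirect. There is no multiplication, so a step
  lengthens the numbers in memory by at most a constant number of bits and the step count agrees
  with Turing machine time up to a polynomial in the number of steps and the bit length of the
  input.
\<close>

type_synonym mem = "string \<Rightarrow> nat \<Rightarrow> nat"

datatype aexp = Num nat | Cell string aexp | Plus aexp aexp | Minus aexp aexp

datatype bexp = Less aexp aexp | BNot bexp | BAnd bexp bexp

datatype com =
    Skip
  | Assign string aexp aexp
  | Flip string aexp
  | Seq com com
  | Cond bexp com com
  | While bexp com

fun aval :: "aexp \<Rightarrow> mem \<Rightarrow> nat" where
  "aval (Num n) M = n"
| "aval (Cell x a) M = M x (aval a M)"
| "aval (Plus a b) M = aval a M + aval b M"
| "aval (Minus a b) M = aval a M - aval b M"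

fun bval :: "bexp \<Rightarrow> mem \<Rightarrow> bool" where
  "bval (Less a b) M \<longleftrightarrow> aval a M < aval b M"
| "bval (BNot b) M \<longleftrightarrow> \<not> bval b M"
| "bval (BAnd b c) M \<longleftrightarrow> bval b M \<and> bval c M"

definition upd :: "mem \<Rightarrow> string \<Rightarrow> nat \<Rightarrow> nat \<Rightarrow> mem" where
  "upd M x i n = M(x := (M x)(i := n))"

text \<open>
  In \<open>exec c M \<omega> t M' \<omega>'\<close>, the program \<open>c\<close> started in memory \<open>M\<close> with the infinite
  coin sequence \<open>\<omega>\<close> halts after \<open>t\<close> steps in memory \<open>M'\<close>, leaving \<open>\<omega>'\<close> unread.
  Every elementary command and every evaluation of a test costs one step; the expressions in it
  contain a number of operations that depends on the program only.
\<close>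

inductive exec :: "com \<Rightarrow> mem \<Rightarrow> bool stream \<Rightarrow> nat \<Rightarrow> mem \<Rightarrow> bool stream \<Rightarrow> bool" where
  Skip: "exec Skip M \<omega> 1 M \<omega>"
| Assign: "exec (Assign x a b) M \<omega> 1 (upd M x (aval a M) (aval b M)) \<omega>"
| Flip: "exec (Flip x a) M \<omega> 1 (upd M x (aval a M) (of_bool (shd \<omega>))) (stl \<omega>)"
| Seq: "exec c M \<omega> t M' \<omega>' \<Longrightarrow> exec d M' \<omega>' t' M'' \<omega>'' \<Longrightarrow>
    exec (Seq c d) M \<omega> (t + t') M'' \<omega>''"
| CondTrue: "bval b M \<Longrightarrow> exec c M \<omega> t M' \<omega>' \<Longrightarrow> exec (Cond b c d) M \<omega> (t + 1) M' \<omega>'"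
| CondFalse: "\<not> bval b M \<Longrightarrow> exec d M \<omega> t M' \<omega>' \<Longrightarrow> exec (Cond b c d) M \<omega> (t + 1) M' \<omega>'"
| WhileFalse: "\<not> bval b M \<Longrightarrow> exec (While b c) M \<omega> 1 M \<omega>"
| WhileTrue: "bval b M \<Longrightarrow> exec c M \<omega> t M' \<omega>' \<Longrightarrow> exec (While b c) M' \<omega>' t' M'' \<omega>'' \<Longrightarrow>
    exec (While b c) M \<omega> (t + t' + 1) M'' \<omega>''"

inductive_cases SkipE: "exec Skip M \<omega> t M' \<omega>'"
  and AssignE: "exec (Assign x a b) M \<omega> t M' \<omega>'"
  and FlipE: "exec (Flip x a) M \<omega> t M' \<omega>'"
  and SeqE: "exec (Seq c d) M \<omega> t M' \<omega>'"
  and CondE: "exec (Cond b c d) M \<omega> t M' \<omega>'"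
  and WhileE: "exec (While b c) M \<omega> t M' \<omega>'"

lemma exec_deterministic:
  "exec c M \<omega> t M1 \<omega>1 \<Longrightarrow> exec c M \<omega> t' M2 \<omega>2 \<Longrightarrow> t' = t \<and> M2 = M1 \<and> \<omega>2 = \<omega>1"
proof (induction arbitrary: t' M2 \<omega>2 rule: exec.induct)
  case (Skip M \<omega>)
  then show ?case by (rule SkipE) simp
next
  case (Assign x a b M \<omega>)
  then show ?case by (rule AssignE) simp
next
  case (Flip x a M \<omega>)
  then show ?case by (rule FlipE) simp
next
  case (Seq c M \<omega> t M' \<omega>' d s M'' \<omega>'')
  from Seq.prems obtain u u' N \<nu>
    where 1: "exec c M \<omega> u N \<nu>" "exec d N \<nu> u' M2 \<omega>2" and "t' = u + u'"
    by (rule SeqE)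
  with Seq.IH(1)[OF 1(1)] Seq.IH(2)[of u' M2 \<omega>2] show ?case by simp
next
  case (CondTrue b M c \<omega> t M' \<omega>' d)
  show ?case using CondTrue.prems by (rule CondE) (use CondTrue.hyps(1) in \<open>auto dest: CondTrue.IH\<close>)
next
  case (CondFalse b M d \<omega> t M' \<omega>' c)
  show ?case using CondFalse.prems by (rule CondE) (use CondFalse.hyps(1) in \<open>auto dest: CondFalse.IH\<close>)
next
  case (WhileFalse b M c \<omega>)
  show ?case using WhileFalse.prems by (rule WhileE) (use WhileFalse.hyps in auto)
next
  case (WhileTrue b M c \<omega> t M' \<omega>' s M'' \<omega>'')
  from WhileTrue.prems WhileTrue.hyps(1) obtain u u' N \<nu>
    where 1: "exec c M \<omega> u N \<nu>" "exec (While b c) N \<nu> u' M2 \<omega>2"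
      and "t' = u + u' + 1"
    by (auto elim: WhileE)
  with WhileTrue.IH(1)[OF 1(1)] WhileTrue.IH(2)[of u' M2 \<omega>2] show ?case by simp
qed

fun coin_free :: "com \<Rightarrow> bool" where
  "coin_free (Flip x a) \<longleftrightarrow> False"
| "coin_free (Seq c d) \<longleftrightarrow> coin_free c \<and> coin_free d"
| "coin_free (Cond b c d) \<longleftrightarrow> coin_free c \<and> coin_free d"
| "coin_free (While b c) \<longleftrightarrow> coin_free c"
| "coin_free _ \<longleftrightarrow> True"

definition input_mem :: "nat list \<Rightarrow> mem" where
  "input_mem xs = (\<lambda>x i. if x = ''in'' \<and> i < length xs then xs ! i else 0)"

definition output_list :: "mem \<Rightarrow> nat list" where
  "output_list M = map (\<lambda>i. M ''out'' (Suc i)) [0..<M ''out'' 0]"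

text \<open>The infimum ranges over at most one value, and is \<open>\<infinity>\<close> if the program does not halt.\<close>

definition run_time :: "com \<Rightarrow> nat list \<Rightarrow> bool stream \<Rightarrow> ennreal" where
  "run_time c xs \<omega> = Inf {of_nat t | t M' \<omega>'. exec c (input_mem xs) \<omega> t M' \<omega>'}"

definition coins :: "bool stream measure" where
  "coins = stream_space (measure_pmf (bernoulli_pmf (1 / 2)))"

definition expected_run_time :: "com \<Rightarrow> nat list \<Rightarrow> ennreal" where
  "expected_run_time c xs = (\<integral>\<^sup>+ \<omega>. run_time c xs \<omega> \<partial>coins)"

section \<open>Hypergraphs as inputs and separators as outputs\<close>

definition lists_hypergraph :: "nat \<Rightarrow> nat list list \<Rightarrow> nat set \<Rightarrow> nat set set \<Rightarrow> bool" where
  "lists_hypergraph n es V E \<longleftrightarrow>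
     V = {..<n} \<and> E = set ` set es \<and> (\<forall>e\<in>set es. distinct e) \<and> distinct (map set es)"

definition encode :: "nat \<Rightarrow> nat list list \<Rightarrow> nat list" where
  "encode n es = n # length es # concat (map (\<lambda>e. length e # e) es)"

text \<open>The output lists the positions of the separating hyperedges in the input.\<close>

definition outputs_separator :: "nat list list \<Rightarrow> nat set \<Rightarrow> nat set set \<Rightarrow> real \<Rightarrow> mem \<Rightarrow> bool" where
  "outputs_separator es V E s M \<longleftrightarrow>
     set (output_list M) \<subseteq> {..<length es} \<and>
     (let R = (\<lambda>i. set (es ! i)) ` set (output_list M)
      in balanced_separator V E R \<and> real (card R) \<le> s)"

end

theory Submission
  imports Defs
begin

text \<open>
  Colour every vertex red with probability \<open>p = 2 powr (- 1 / r)\<close> and blue otherwise. A hyperedge of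
  size \<open>r\<close> is then entirely red with probability \<open>1 / 2\<close> and entirely blue with probability
  \<open>eps r\<close>, and smaller hyperedges only do better. Removing the bichromatic hyperedges, and surplus
  monochromatic ones of a colour with more than \<open>m / 2\<close> of them, leaves a hypergraph in which every
  component has one colour.

  A colouring with nearly the expected numbers of red and blue hyperedges is found deterministically
  in polynomial time: colour the vertices one after the other, keeping the conditional expectations
  \<open>X\<close> and \<open>Y\<close> of these two numbers close to their initial values. The better of the two choices
  for a vertex \<open>v\<close> increases \<open>(X - X0)\<^sup>2 + (Y - Y0)\<^sup>2\<close> by at most the square of the degree of \<open>v\<close>, so
  that in the end it is at most \<open>k r m = o(m\<^sup>2)\<close>. To stay within the integers, \<open>p\<close> is
  replaced by a multiple of \<open>1 / m\<close>, which costs only \<open>O(1)\<close> hyperedges. The resulting coin-free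
  program serves for all three claims.
\<close>

section \<open>Two-coloured edges give a balanced separator\<close>

definition mono_on_edge :: "('a \<Rightarrow> bool) \<Rightarrow> 'a set \<Rightarrow> bool" where
  "mono_on_edge P e \<longleftrightarrow> (\<forall>v\<in>e. P v) \<or> (\<forall>v\<in>e. \<not> P v)"

text \<open>Consecutive hyperedges of the walk share a vertex, which hands the colour of one
  monochromatic hyperedge on to the next.\<close>

lemma walk_constant:
  assumes "es \<noteq> []" "\<forall>e\<in>set es. mono_on_edge P e" "u \<in> hd es" "v \<in> last es"
    "\<forall>i. Suc i < length es \<longrightarrow> es ! i \<inter> es ! Suc i \<noteq> {}"
  shows "P u \<longleftrightarrow> P v"
  using assms
proof (induction es arbitrary: u rule: list_nonempty_induct)
  case (single x)
  then show ?case by (auto simp: mono_on_edge_def)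
next
  case (cons x xs)
  have "x \<inter> hd xs \<noteq> {}"
    using cons.prems(4)[rule_format, of 0] cons.hyps by (simp add: hd_conv_nth[of xs])
  then obtain w where w: "w \<in> x" "w \<in> hd xs" by auto
  have "\<forall>i. Suc i < length xs \<longrightarrow> xs ! i \<inter> xs ! Suc i \<noteq> {}"
  proof (intro allI impI)
    fix i assume "Suc i < length xs"
    then show "xs ! i \<inter> xs ! Suc i \<noteq> {}" using cons.prems(4)[rule_format, of "Suc i"] by simp
  qed
  then have "P w \<longleftrightarrow> P v"
    using cons.IH[OF _ w(2)] cons.prems(1,3) cons.hyps by simp
  moreover have "P u \<longleftrightarrow> P w" using cons.prems(1,2) w(1) by (auto simp: mono_on_edge_def)
  ultimately show ?case by simp
qed

lemma component_monochromatic: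
  assumes "hyper_component V K S" "\<forall>e\<in>K. mono_on_edge P e" "u \<in> S" "v \<in> S"
  shows "P u \<longleftrightarrow> P v"
proof (cases "linked_set V K S")
  case True
  then obtain es where "edge_walk_in K S u v es" using assms(3,4) unfolding linked_set_def by blast
  then show ?thesis using walk_constant[of es P u v] assms(2) unfolding edge_walk_in_def by blast
next
  case False
  \<comment> \<open>An unlinked component can only come from the clause for isolated vertices, so it
    is a singleton.\<close>
  then show ?thesis using assms(1,3,4) unfolding hyper_component_def by auto
qed

text \<open>\<open>K1\<close> and \<open>K2\<close> are the hyperedges that stay. Every component
  they form has one colour, so it meets hyperedges of only one of the two families, and each family
  has at most half of all hyperedges.\<close>

lemma balanced_separator_two_colours:
  assumes "finite E" "K1 \<subseteq> E" "K2 \<subseteq> E" "2 * card K1 \<le> card E" "2 * card K2 \<le> card E"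
    and K1: "\<forall>e\<in>K1. \<forall>v\<in>e. P v" and K2: "\<forall>e\<in>K2. \<forall>v\<in>e. \<not> P v"
  shows "balanced_separator V E (E - (K1 \<union> K2))"
  unfolding balanced_separator_def
proof (intro conjI allI impI)
  have eq: "E - (E - (K1 \<union> K2)) = K1 \<union> K2" using assms by auto
  fix S assume "hyper_component V (E - (E - (K1 \<union> K2))) S"
  then have S: "hyper_component V (K1 \<union> K2) S" unfolding eq .
  have mono: "P u \<longleftrightarrow> P v" if "u \<in> S" "v \<in> S" for u v
    by (rule component_monochromatic[OF S _ that]) (use K1 K2 in \<open>auto simp: mono_on_edge_def\<close>)
  have fin: "finite K1" "finite K2" using assms(1-3) by (auto intro: finite_subset)
  \<comment> \<open>A counted hyperedge shares a vertex with \<open>S\<close>, so its colour is the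
    colour of all of \<open>S\<close>.\<close>
  have "{e \<in> K1 \<union> K2. e \<inter> S \<noteq> {}} \<subseteq> K1 \<or> {e \<in> K1 \<union> K2. e \<inter> S \<noteq> {}} \<subseteq> K2"
    using mono K1 K2 by blast
  then have "card {e \<in> K1 \<union> K2. e \<inter> S \<noteq> {}} \<le> card K1 \<or>
      card {e \<in> K1 \<union> K2. e \<inter> S \<noteq> {}} \<le> card K2"
    using fin by (auto intro: card_mono)
  then show "real (card {e \<in> E - (E - (K1 \<union> K2)). e \<inter> S \<noteq> {}}) \<le> real (card E) / 2"
    unfolding eq using assms by linarith
qed auto

section \<open>Conditional expectations\<close>

text \<open>If each vertex \<open>v\<close> independently gets a fixed colour with probability
  \<open>\<phi> v\<close>, this is the expected number of hyperedges entirely of that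
  colour.\<close>

definition expected_mono :: "('a \<Rightarrow> real) \<Rightarrow> 'a set set \<Rightarrow> real" where
  "expected_mono \<phi> E = (\<Sum>e\<in>E. \<Prod>v\<in>e. \<phi> v)"

text \<open>The expectation is affine in each single probability. The slope \<open>A\<close> sums,
  over the hyperedges at \<open>v\<close>, the probability that all their other vertices have the
  colour; each summand is at most 1.\<close>

lemma expected_mono_update:
  assumes "finite E" "\<forall>e\<in>E. finite e" "\<forall>v. 0 \<le> \<phi> v \<and> \<phi> v \<le> 1"
  obtains A where "0 \<le> A" "A \<le> real (vdegree E v)"
    "\<And>t. expected_mono (\<phi>(v := t)) E = expected_mono \<phi> E + (t - \<phi> v) * A"
proof
  define A where "A = (\<Sum>e\<in>{e\<in>E. v \<in> e}. \<Prod>w\<in>e - {v}. \<phi> w)"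
  show "0 \<le> A" unfolding A_def using assms by (auto intro!: sum_nonneg prod_nonneg)
  have "A \<le> (\<Sum>e\<in>{e\<in>E. v \<in> e}. 1)"
    unfolding A_def using assms by (intro sum_mono prod_le_1) auto
  then show "A \<le> real (vdegree E v)" unfolding vdegree_def by simp
  have remove: "(\<Prod>w\<in>e. \<psi> w) = \<psi> v * (\<Prod>w\<in>e - {v}. \<psi> w)"
    if "e \<in> E" "v \<in> e" for e and \<psi> :: "'a \<Rightarrow> real"
    using prod.remove[of e v \<psi>] assms that by auto
  fix t
  have *: "(\<Prod>w\<in>e. (\<phi>(v := t)) w) =
      (\<Prod>w\<in>e. \<phi> w) + (if v \<in> e then (t - \<phi> v) * (\<Prod>w\<in>e - {v}. \<phi> w) else 0)"
    if "e \<in> E" for e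
  proof (cases "v \<in> e")
    case True
    have "(\<Prod>w\<in>e - {v}. (\<phi>(v := t)) w) = (\<Prod>w\<in>e - {v}. \<phi> w)" by (rule prod.cong) auto
    then show ?thesis using True remove[OF that True, of "\<phi>(v := t)"] remove[OF that True, of \<phi>]
      by (simp add: algebra_simps)
  next
    case False
    then show ?thesis by (auto intro!: prod.cong)
  qed
  have "(\<Sum>e\<in>E. if v \<in> e then (t - \<phi> v) * (\<Prod>w\<in>e - {v}. \<phi> w) else 0) = (t - \<phi> v) * A"
    unfolding A_def sum_distrib_left by (rule sum.inter_filter[symmetric, OF assms(1)])
  then show "expected_mono (\<phi>(v := t)) E = expected_mono \<phi> E + (t - \<phi> v) * A"
    unfolding expected_mono_def using * by (simp add: sum.distrib)
qed

text \<open>Code 0 means undecided and 1 red; every other code counts as blue.\<close>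

definition red_prob :: "real \<Rightarrow> nat \<Rightarrow> real" where
  "red_prob p c = (if c = 0 then p else if c = 1 then 1 else 0)"

text \<open>One quadratic potential controls both expectations at once. A random choice for
  \<open>v\<close> leaves both unchanged on average, so the mean potential grows by a variance only,
  and the better choice is no worse than the mean.\<close>

lemma steering_step:
  fixes x y p :: real
  assumes E: "finite E" "\<forall>e\<in>E. finite e" and p: "0 \<le> p" "p \<le> 1" and "c v = 0"
  defines "\<Phi> \<equiv> \<lambda>c :: 'a \<Rightarrow> nat. (expected_mono (\<lambda>v. red_prob p (c v)) E - x)\<^sup>2
      + (expected_mono (\<lambda>v. 1 - red_prob p (c v)) E - y)\<^sup>2"
  shows "min (\<Phi> (c(v := 1))) (\<Phi> (c(v := 2))) \<le> \<Phi> c + (real (vdegree E v))\<^sup>2"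
proof -
  let ?f = "\<lambda>v. red_prob p (c v)"
  let ?d = "real (vdegree E v)"
  obtain A where A: "0 \<le> A" "A \<le> ?d"
    "\<And>t. expected_mono (?f(v := t)) E = expected_mono ?f E + (t - ?f v) * A"
    by (rule expected_mono_update[OF E, of ?f v]) (use p in \<open>auto simp: red_prob_def\<close>)
  let ?g = "\<lambda>v. 1 - red_prob p (c v)"
  obtain B where B: "0 \<le> B" "B \<le> ?d"
    "\<And>t. expected_mono (?g(v := t)) E = expected_mono ?g E + (t - ?g v) * B"
    by (rule expected_mono_update[OF E, of ?g v]) (use p in \<open>auto simp: red_prob_def\<close>)
  define X where "X = expected_mono ?f E - x"
  define Y where "Y = expected_mono ?g E - y"
  have fv: "?f v = p" using \<open>c v = 0\<close> by (simp add: red_prob_def)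
  have e: "(\<lambda>w. red_prob p ((c(v := 1)) w)) = ?f(v := 1)" "(\<lambda>w. red_prob p ((c(v := 2)) w)) = ?f(v := 0)"
    "(\<lambda>w. 1 - red_prob p ((c(v := 1)) w)) = ?g(v := 0)"
    "(\<lambda>w. 1 - red_prob p ((c(v := 2)) w)) = ?g(v := 1)"
    by (auto simp: red_prob_def)
  have 1: "\<Phi> (c(v := 1)) = (X + (1 - p) * A)\<^sup>2 + (Y - (1 - p) * B)\<^sup>2"
    unfolding \<Phi>_def e A(3) B(3) fv X_def Y_def by (simp add: algebra_simps)
  have 2: "\<Phi> (c(v := 2)) = (X - p * A)\<^sup>2 + (Y + p * B)\<^sup>2"
    unfolding \<Phi>_def e A(3) B(3) fv X_def Y_def by (simp add: algebra_simps)
  have 0: "\<Phi> c = X\<^sup>2 + Y\<^sup>2" unfolding \<Phi>_def X_def Y_def ..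
  \<comment> \<open>With weights \<open>p\<close> and \<open>1 - p\<close> the shifts
    \<open>(1 - p) * A\<close> and \<open>- p * A\<close> of \<open>X\<close> average to zero, and
    so do those of \<open>Y\<close>. The terms linear in \<open>X\<close> and \<open>Y\<close>
    cancel and only the second moments remain.\<close>
  have avg: "p * \<Phi> (c(v := 1)) + (1 - p) * \<Phi> (c(v := 2)) = \<Phi> c + p * (1 - p) * (A\<^sup>2 + B\<^sup>2)"
    unfolding 0 1 2 by (simp add: power2_eq_square algebra_simps)
  \<comment> \<open>The constant 1/2 is enough: it meets the factor 2 in the bound on the sum of the
    two squared slopes and leaves one squared degree.\<close>
  have "p * (1 - p) \<le> 1/2"
    using zero_le_power2[of "p - 1/2"] by (simp add: power2_eq_square algebra_simps)
  moreover have "A\<^sup>2 \<le> ?d\<^sup>2" "B\<^sup>2 \<le> ?d\<^sup>2" using A B by (auto intro: power_mono)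
  then have "A\<^sup>2 + B\<^sup>2 \<le> 2 * ?d\<^sup>2" by simp
  ultimately have "p * (1 - p) * (A\<^sup>2 + B\<^sup>2) \<le> (1/2) * (2 * ?d\<^sup>2)"
    by (intro mult_mono) auto
  moreover have "min (\<Phi> (c(v := 1))) (\<Phi> (c(v := 2))) \<le> p * \<Phi> (c(v := 1)) + (1 - p) * \<Phi> (c(v := 2))"
  proof -
    let ?m = "min (\<Phi> (c(v := 1))) (\<Phi> (c(v := 2)))"
    have "p * ?m + (1 - p) * ?m \<le> p * \<Phi> (c(v := 1)) + (1 - p) * \<Phi> (c(v := 2))"
      using p by (intro add_mono mult_left_mono) auto
    then show ?thesis by (simp add: algebra_simps)
  qed
  ultimately show ?thesis using avg by linarith
qed

section \<open>The algorithm on lists\<close>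

text \<open>
  With \<open>p = a / D\<close>, probabilities are scaled by \<open>D ^ r\<close>, which makes them natural numbers; the
  missing vertices of a hyperedge with fewer than \<open>r\<close> vertices count with probability 1. The colour
  of a vertex is 0 as long as it is not chosen, 1 for red and 2 for blue.
\<close>

definition edge_weight :: "nat \<Rightarrow> nat \<Rightarrow> ('a \<Rightarrow> nat) \<Rightarrow> 'a list \<Rightarrow> nat" where
  "edge_weight r D h e = (\<Prod>j<r. if j < length e then h (e ! j) else D)"

definition red_factor :: "nat \<Rightarrow> nat \<Rightarrow> nat \<Rightarrow> nat" where
  "red_factor D a c = (if c = 0 then a else if c = 1 then D else 0)"

definition blue_factor :: "nat \<Rightarrow> nat \<Rightarrow> nat \<Rightarrow> nat" where
  "blue_factor D a c = (if c = 0 then D - a else if c = 1 then 0 else D)"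

definition red_weight :: "nat \<Rightarrow> 'a list list \<Rightarrow> nat \<Rightarrow> ('a \<Rightarrow> nat) \<Rightarrow> nat \<Rightarrow> nat" where
  "red_weight r es a c i = edge_weight r (length es) (\<lambda>v. red_factor (length es) a (c v)) (es ! i)"

definition blue_weight :: "nat \<Rightarrow> 'a list list \<Rightarrow> nat \<Rightarrow> ('a \<Rightarrow> nat) \<Rightarrow> nat \<Rightarrow> nat" where
  "blue_weight r es a c i = edge_weight r (length es) (\<lambda>v. blue_factor (length es) a (c v)) (es ! i)"

definition red_total :: "nat \<Rightarrow> 'a list list \<Rightarrow> nat \<Rightarrow> ('a \<Rightarrow> nat) \<Rightarrow> nat" where
  "red_total r es a c = (\<Sum>i<length es. red_weight r es a c i)"

definition blue_total :: "nat \<Rightarrow> 'a list list \<Rightarrow> nat \<Rightarrow> ('a \<Rightarrow> nat) \<Rightarrow> nat" where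
  "blue_total r es a c = (\<Sum>i<length es. blue_weight r es a c i)"

text \<open>For \<open>a = length es\<close> all weights are full, so the left side is the scaled
  number of hyperedges: at least half of them are to be red in expectation. The least such
  \<open>a\<close> is the most favourable to blue.\<close>

definition bias :: "nat \<Rightarrow> 'a list list \<Rightarrow> nat" where
  "bias r es = (LEAST a. red_total r es (length es) (\<lambda>_. 0) \<le> 2 * red_total r es a (\<lambda>_. 0))"

definition distance :: "nat \<Rightarrow> nat \<Rightarrow> nat" where
  "distance x y = (x - y) + (y - x)"

definition imbalance :: "nat \<Rightarrow> 'a list list \<Rightarrow> nat \<Rightarrow> ('a \<Rightarrow> nat) \<Rightarrow> nat" where
  "imbalance r es a c =
     (distance (red_total r es a c) (red_total r es a (\<lambda>_. 0)))\<^sup>2 +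
     (distance (blue_total r es a c) (blue_total r es a (\<lambda>_. 0)))\<^sup>2"

text \<open>The test \<open>c v = 0\<close> makes repetitions in the list of vertices
  harmless.\<close>

definition colour_vertex :: "nat \<Rightarrow> 'a list list \<Rightarrow> nat \<Rightarrow> 'a \<Rightarrow> ('a \<Rightarrow> nat) \<Rightarrow> 'a \<Rightarrow> nat" where
  "colour_vertex r es a v c =
     (if c v = 0
      then if imbalance r es a (c(v := 1)) < imbalance r es a (c(v := 2)) then c(v := 1) else c(v := 2)
      else c)"

definition colouring :: "nat \<Rightarrow> 'a list list \<Rightarrow> 'a list \<Rightarrow> 'a \<Rightarrow> nat" where
  "colouring r es xs = fold (colour_vertex r es (bias r es)) xs (\<lambda>_. 0)"

text \<open>The inequality says that \<open>i\<close> and the earlier positions satisfying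
  \<open>P\<close> together number at most \<open>m div 2\<close>.\<close>

definition among_first :: "nat \<Rightarrow> (nat \<Rightarrow> bool) \<Rightarrow> nat \<Rightarrow> bool" where
  "among_first m P i \<longleftrightarrow> P i \<and> 2 * card {l. l < i \<and> P l} + 1 < m"

text \<open>The empty hyperedge has positive weight in both colours, and counts as red only.\<close>

definition kept :: "nat \<Rightarrow> (nat \<Rightarrow> nat) \<Rightarrow> (nat \<Rightarrow> nat) \<Rightarrow> nat \<Rightarrow> bool" where
  "kept m x y i \<longleftrightarrow> among_first m (\<lambda>i. 0 < x i) i \<or> among_first m (\<lambda>i. x i = 0 \<and> 0 < y i) i"

definition separator :: "nat \<Rightarrow> 'a list list \<Rightarrow> 'a list \<Rightarrow> nat list" where
  "separator r es xs =
     (let c = colouring r es xs; a = bias r es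
      in filter (\<lambda>i. \<not> kept (length es) (red_weight r es a c) (blue_weight r es a c) i) [0..<length es])"

text \<open>Positions beyond the end of \<open>e\<close> contribute the factor \<open>D\<close>,
  which becomes 1 after scaling.\<close>

lemma edge_weight_eq:
  assumes "distinct e" "length e \<le> r" "D > 0"
  shows "real (edge_weight r D h e) = real D ^ r * (\<Prod>v\<in>set e. real (h v) / real D)"
proof -
  have "edge_weight r D h e = (\<Prod>j\<in>{..<length e} \<union> {length e..<r}. if j < length e then h (e ! j) else D)"
    unfolding edge_weight_def using assms by (intro prod.cong) auto
  also have "\<dots> = (\<Prod>j<length e. h (e ! j)) * D ^ (r - length e)"
    by (subst prod.union_disjoint) auto
  also have "(\<Prod>j<length e. h (e ! j)) = (\<Prod>v\<in>set e. h v)"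
    using prod.reindex_bij_betw[OF bij_betw_nth[OF assms(1) refl refl], of h] by simp
  finally have "real (edge_weight r D h e) = (\<Prod>v\<in>set e. real (h v)) * real D ^ (r - length e)"
    by simp
  also have "real D ^ (r - length e) = real D ^ r / real D ^ length e"
    using assms by (simp add: power_diff)
  finally show ?thesis using assms by (simp add: prod_dividef distinct_card)
qed

lemma card_among_first:
  "card {i. i < n \<and> among_first m P i} = min (card {i. i < n \<and> P i}) (m div 2)"
proof (induction n)
  case (Suc n)
  have split: "{i. i < Suc n \<and> Q i} = (if Q n then insert n {i. i < n \<and> Q i} else {i. i < n \<and> Q i})" for Q
    by (auto simp: less_Suc_eq)
  show ?case using Suc unfolding split by (auto simp: among_first_def)
qed simp

text \<open>Serves twice: capping the blue hyperedges at half of all does not spoil their lower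
  bound, and the exponent in the deterministic time bound is nonnegative.\<close>

lemma eps_le_half:
  assumes "r > 0"
  shows "eps r \<le> 1 / 2"
proof -
  have "2 powr (- 1) \<le> (2::real) powr (- 1 / real r)"
    using assms by (intro powr_mono) (auto simp: field_simps)
  then have "1 - 2 powr (- 1 / real r) \<le> (1 / 2 :: real)" by (simp add: powr_minus_divide)
  moreover have "2 powr (- 1 / real r) \<le> (2::real) powr 0" by (intro powr_mono) auto
  ultimately have "(1 - 2 powr (- 1 / real r)) ^ r \<le> (1 / 2 :: real) ^ r" by (intro power_mono) auto
  also have "\<dots> \<le> (1 / 2) ^ 1" using assms by (intro power_decreasing) auto
  finally show ?thesis by (simp add: eps_def)
qed

lemma eps_nonneg: "0 \<le> eps r"
proof -
  have "2 powr (- 1 / real r) \<le> (2::real) powr 0" by (intro powr_mono) auto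
  then show ?thesis by (simp add: eps_def)
qed

section \<open>Expected numbers of red and blue hyperedges for a list of distinct hyperedges\<close>

locale edge_list =
  fixes r :: nat and es :: "'a list list"
  assumes edges: "\<And>e. e \<in> set es \<Longrightarrow> distinct e" "\<And>e. e \<in> set es \<Longrightarrow> length e \<le> r"
    and distinct_sets: "distinct (map set es)"
begin

abbreviation "E \<equiv> set ` set es"
abbreviation "m \<equiv> length es"

lemma card_E: "card E = m"
  using distinct_card[OF distinct_sets] by simp

lemma inj_edges: "inj_on (\<lambda>i. set (es ! i)) {..<m}"
  using inj_on_nth[OF distinct_sets, of "{..<m}"] unfolding inj_on_def by simp

lemma bij_edges: "bij_betw (\<lambda>i. set (es ! i)) {..<m} E"
  unfolding bij_betw_def using inj_edges by (force simp: in_set_conv_nth image_iff)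

lemma total_eq:
  "(\<Sum>i<m. real (edge_weight r m h (es ! i))) = real m ^ r * expected_mono (\<lambda>v. real (h v) / real m) E"
proof -
  have "(\<Sum>i<m. real (edge_weight r m h (es ! i)))
      = (\<Sum>i<m. real m ^ r * (\<Prod>v\<in>set (es ! i). real (h v) / real m))"
    using edges by (intro sum.cong edge_weight_eq) auto
  then show ?thesis unfolding expected_mono_def
    using sum.reindex_bij_betw[OF bij_edges, of "\<lambda>e. \<Prod>v\<in>e. real (h v) / real m"]
    by (simp add: sum_distrib_left[symmetric])
qed

lemma red_total_eq:
  assumes "m > 0"
  shows "real (red_total r es a c) = real m ^ r * expected_mono (\<lambda>v. red_prob (a / m) (c v)) E"
proof -
  have "(\<lambda>v. real (red_factor m a (c v)) / real m) = (\<lambda>v. red_prob (a / m) (c v))"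
    using assms by (auto simp: red_factor_def red_prob_def)
  then show ?thesis unfolding red_total_def red_weight_def
    using total_eq[of "\<lambda>v. red_factor m a (c v)"] by simp
qed

text \<open>With \<open>a \<le> m\<close> the truncated subtraction in \<open>blue_factor\<close> is
  exact.\<close>

lemma blue_total_eq:
  assumes "m > 0" "a \<le> m"
  shows "real (blue_total r es a c) = real m ^ r * expected_mono (\<lambda>v. 1 - red_prob (a / m) (c v)) E"
proof -
  have "(\<lambda>v. real (blue_factor m a (c v)) / real m) = (\<lambda>v. 1 - red_prob (a / m) (c v))"
    using assms by (auto simp: blue_factor_def red_prob_def field_simps)
  then show ?thesis unfolding blue_total_def blue_weight_def
    using total_eq[of "\<lambda>v. blue_factor m a (c v)"] by simp
qed

lemma bias_le: "bias r es \<le> m"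
  unfolding bias_def by (rule Least_le) simp

lemma bias_works: "red_total r es m (\<lambda>_. 0) \<le> 2 * red_total r es (bias r es) (\<lambda>_. 0)"
  unfolding bias_def by (rule LeastI[of _ m]) simp

lemma less_bias: "a < bias r es \<Longrightarrow> 2 * red_total r es a (\<lambda>_. 0) < red_total r es m (\<lambda>_. 0)"
  unfolding bias_def by (drule not_less_Least) simp

lemma expected_mono_const: "expected_mono (\<lambda>_. q) E = (\<Sum>e\<in>E. q ^ card e)"
  unfolding expected_mono_def by simp

lemma expected_mono_const_ge:
  assumes "0 \<le> q" "q \<le> 1"
  shows "expected_mono (\<lambda>_. q) E \<ge> real m * q ^ r"
proof -
  have "(\<Sum>e\<in>E. q ^ r) \<le> (\<Sum>e\<in>E. q ^ card e)"
    using assms edges by (intro sum_mono power_decreasing) (auto simp: distinct_card)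
  then show ?thesis by (simp add: expected_mono_const card_E)
qed

lemma expected_red_ge:
  assumes "m > 0"
  shows "expected_mono (\<lambda>_. real (bias r es) / m) E \<ge> real m / 2"
proof -
  have "real (red_total r es m (\<lambda>_. 0)) \<le> 2 * real (red_total r es (bias r es) (\<lambda>_. 0))"
    using bias_works by linarith
  then have "expected_mono (\<lambda>_. 1) E \<le> 2 * expected_mono (\<lambda>_. real (bias r es) / m) E"
    unfolding red_total_eq[OF assms] using assms by (simp add: red_prob_def)
  then show ?thesis by (simp add: expected_mono_const card_E)
qed

text \<open>By minimality of \<open>bias\<close>, the next smaller multiple \<open>q\<close> of
  \<open>1 / m\<close> makes fewer than half of the hyperedges red in expectation, so
  \<open>q ^ r < 1 / 2\<close> and \<open>q\<close> lies below the ideal probability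
  \<open>s\<close>. Thus \<open>p\<close> exceeds \<open>s\<close> by at most \<open>1 / m\<close>,
  which costs at most \<open>r / m\<close> per hyperedge.\<close>

lemma expected_blue_ge:
  assumes "m > 0" "r > 0"
  shows "expected_mono (\<lambda>_. 1 - real (bias r es) / m) E \<ge> eps r * real m - real r"
proof -
  define p where "p = real (bias r es) / m"
  define s :: real where "s = 2 powr (- 1 / real r)"
  have p: "0 \<le> p" "p \<le> 1" using bias_le assms by (auto simp: p_def)
  have "2 powr (- 1 / real r) \<le> (2::real) powr 0" by (intro powr_mono) auto
  then have s: "0 \<le> s" "s \<le> 1" by (simp_all add: s_def)
  have sr: "s ^ r = 1 / 2"
  proof -
    have "s ^ r = 2 powr (- 1 / real r * real r)"
      unfolding s_def by (simp add: powr_realpow[symmetric] powr_powr)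
    then show ?thesis using assms by (simp add: powr_minus_divide)
  qed
  have ps: "p \<le> s + 1 / m"
  proof (cases "bias r es")
    case 0
    then show ?thesis using s by (simp add: p_def)
  next
    case (Suc b)
    define q where "q = real b / m"
    have q: "0 \<le> q" "q \<le> 1" using bias_le assms Suc by (auto simp: q_def)
    have "2 * red_total r es b (\<lambda>_. 0) < red_total r es m (\<lambda>_. 0)" using Suc by (intro less_bias) simp
    then have "2 * real (red_total r es b (\<lambda>_. 0)) < real (red_total r es m (\<lambda>_. 0))" by linarith
    then have "2 * expected_mono (\<lambda>_. q) E < expected_mono (\<lambda>_. 1) E"
      unfolding red_total_eq[OF assms(1)] using assms by (simp add: red_prob_def q_def)
    then have "real m * (2 * q ^ r) < real m * 1"
      using expected_mono_const_ge[OF q] by (simp add: expected_mono_const card_E)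
    then have "q ^ r < s ^ r" using assms sr by (simp add: mult_less_cancel_left)
    then have "q < s" using s by (simp add: power_less_imp_less_base)
    then show ?thesis by (simp add: p_def q_def Suc field_simps add_divide_distrib)
  qed
  have "(1 - p) ^ r \<ge> eps r - real r / m"
  proof (cases "p \<le> s")
    case True
    then have "(1 - s) ^ r \<le> (1 - p) ^ r" using s by (intro power_mono) auto
    moreover have "0 \<le> real r / m" by simp
    ultimately show ?thesis unfolding eps_def s_def by linarith
  next
    case False
    \<comment> \<open>On the unit interval the \<open>r\<close>-th power is Lipschitz with constant
      \<open>r\<close>.\<close>
    have "\<bar>(1 - s) ^ r - (1 - p) ^ r\<bar> \<le> real r * \<bar>(1 - s) - (1 - p)\<bar>"
      using norm_power_diff[of "1 - s" "1 - p" r] s p by simp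
    also have "\<dots> \<le> real r * (1 / m)" using False ps by (intro mult_left_mono) auto
    finally show ?thesis by (simp add: eps_def s_def)
  qed
  then have "real m * (1 - p) ^ r \<ge> real m * (eps r - real r / m)" by (rule mult_left_mono) simp
  also have "real m * (eps r - real r / m) = eps r * real m - real r"
    using assms by (simp add: field_simps)
  finally show ?thesis using expected_mono_const_ge[of "1 - p"] p by (simp add: p_def)
qed

section \<open>The squared deviation from the initial expectations along the colouring\<close>

definition deviation :: "('a \<Rightarrow> nat) \<Rightarrow> real" where
  "deviation c =
     (expected_mono (\<lambda>v. red_prob (bias r es / m) (c v)) E - expected_mono (\<lambda>_. bias r es / m) E)\<^sup>2 +
     (expected_mono (\<lambda>v. 1 - red_prob (bias r es / m) (c v)) E - expected_mono (\<lambda>_. 1 - bias r es / m) E)\<^sup>2"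

text \<open>The scaling factor is positive and the same for all colourings, so the program's integer
  comparisons are comparisons of \<open>deviation\<close>.\<close>

lemma imbalance_eq:
  assumes "m > 0"
  shows "real (imbalance r es (bias r es) c) = (real m ^ r)\<^sup>2 * deviation c"
proof -
  have dist: "(real (distance x y))\<^sup>2 = (real x - real y)\<^sup>2" for x y
    unfolding distance_def by (cases "x \<le> y") (auto simp: of_nat_diff power2_commute)
  show ?thesis
    unfolding imbalance_def deviation_def of_nat_add of_nat_power dist
      red_total_eq[OF assms] blue_total_eq[OF assms bias_le]
    by (simp add: red_prob_def power_mult_distrib[symmetric] algebra_simps)
qed

lemma deviation_colour_vertex:
  assumes "m > 0"
  shows "deviation (colour_vertex r es (bias r es) v c) \<le>
    deviation c + (if c v = 0 then (real (vdegree E v))\<^sup>2 else 0)"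
proof (cases "c v = 0")
  case True
  have "min (deviation (c(v := 1))) (deviation (c(v := 2))) \<le> deviation c + (real (vdegree E v))\<^sup>2"
    unfolding deviation_def
    by (rule steering_step) (use True bias_le assms in auto)
  moreover have "imbalance r es (bias r es) c1 < imbalance r es (bias r es) c2 \<longleftrightarrow> deviation c1 < deviation c2"
    for c1 c2
    using assms imbalance_eq[of c1] imbalance_eq[of c2]
    by (metis mult_less_cancel_left_pos of_nat_0_less_iff of_nat_less_iff zero_less_power)
  ultimately show ?thesis using True unfolding colour_vertex_def by (auto simp: min_def split: if_splits)
next
  case False
  then show ?thesis by (simp add: colour_vertex_def)
qed

lemma colour_vertex_values:
  "colour_vertex r es a v c w \<noteq> 0 \<longleftrightarrow> c w \<noteq> 0 \<or> w = v"
  "c w \<le> 2 \<Longrightarrow> colour_vertex r es a v c w \<le> 2"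
  by (auto simp: colour_vertex_def)

lemma colouring_deviation:
  fixes xs :: "'a list"
  assumes "m > 0"
  defines "c \<equiv> colouring r es xs"
  shows "deviation c \<le> (\<Sum>v\<in>set xs. (real (vdegree E v))\<^sup>2)" "\<And>v. c v \<noteq> 0 \<longleftrightarrow> v \<in> set xs" "\<And>v. c v \<le> 2"
proof -
  have "deviation c \<le> (\<Sum>v\<in>set xs. (real (vdegree E v))\<^sup>2) \<and> (\<forall>v. c v \<noteq> 0 \<longleftrightarrow> v \<in> set xs) \<and> (\<forall>v. c v \<le> 2)"
    unfolding c_def colouring_def
  proof (induction xs rule: rev_induct)
    case Nil
    show ?case by (simp add: deviation_def red_prob_def)
  next
    case (snoc v xs)
    let ?c = "fold (colour_vertex r es (bias r es)) xs (\<lambda>_. 0)"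
    have "deviation (colour_vertex r es (bias r es) v ?c) \<le> (\<Sum>v\<in>set (xs @ [v]). (real (vdegree E v))\<^sup>2)"
    \<comment> \<open>A repeated vertex is already coloured and adds nothing, so the sum runs over
      the set of entries.\<close>
    proof (cases "v \<in> set xs")
      case True
      then have "?c v \<noteq> 0" using snoc.IH by blast
      then show ?thesis
        using deviation_colour_vertex[OF assms(1), of v ?c] snoc.IH True by (simp add: insert_absorb)
    next
      case False
      then show ?thesis
        using deviation_colour_vertex[OF assms(1), of v ?c] snoc.IH by (auto split: if_splits)
    qed
    then show ?case using snoc.IH colour_vertex_values(1)[of "bias r es" v ?c]
        colour_vertex_values(2)[of ?c _ "bias r es" v] by auto
  qed
  then show "deviation c \<le> (\<Sum>v\<in>set xs. (real (vdegree E v))\<^sup>2)" "\<And>v. c v \<noteq> 0 \<longleftrightarrow> v \<in> set xs"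
    "\<And>v. c v \<le> 2" by auto
qed

text \<open>Double counting of incidences: each hyperedge contains at most \<open>r\<close> vertices
  of \<open>A\<close>.\<close>

lemma sum_vdegree: "finite A \<Longrightarrow> (\<Sum>v\<in>A. vdegree E v) \<le> r * m"
proof -
  assume A: "finite A"
  have "vdegree E v = (\<Sum>e\<in>E. of_bool (v \<in> e))" for v
    unfolding vdegree_def by (simp add: Int_def)
  then have "(\<Sum>v\<in>A. vdegree E v) = (\<Sum>v\<in>A. \<Sum>e\<in>E. of_bool (v \<in> e))" by simp
  also have "\<dots> = (\<Sum>e\<in>E. \<Sum>v\<in>A. of_bool (v \<in> e))" by (rule sum.swap)
  also have "\<dots> \<le> (\<Sum>e\<in>E. r)"
  proof (rule sum_mono)
    fix e assume "e \<in> E"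
    then have "card e \<le> r" "finite e" using edges by (auto simp: distinct_card)
    moreover have "card (A \<inter> e) \<le> card e" using \<open>finite e\<close> by (intro card_mono) auto
    ultimately show "(\<Sum>v\<in>A. of_bool (v \<in> e)) \<le> r" using A by simp
  qed
  finally show ?thesis by (simp add: card_E mult.commute)
qed

text \<open>One factor of each square is bounded by \<open>d\<close>, the other is summed by double
  counting.\<close>

lemma sum_vdegree_square:
  assumes "finite A" "\<And>v. real (vdegree E v) \<le> d"
  shows "(\<Sum>v\<in>A. (real (vdegree E v))\<^sup>2) \<le> d * real r * real m"
proof -
  have "0 \<le> real (vdegree E undefined)" by simp
  then have d: "0 \<le> d" using assms(2) by (rule order_trans)
  have "(\<Sum>v\<in>A. (real (vdegree E v))\<^sup>2) \<le> (\<Sum>v\<in>A. d * real (vdegree E v))"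
    unfolding power2_eq_square using assms(2) by (intro sum_mono mult_right_mono) auto
  also have "\<dots> = d * real (\<Sum>v\<in>A. vdegree E v)" by (simp add: sum_distrib_left)
  also have "\<dots> \<le> d * real (r * m)"
    using sum_vdegree[OF assms(1)] d by (intro mult_left_mono of_nat_mono)
  finally show ?thesis by simp
qed

section \<open>From the final colouring to the separator\<close>

lemma expected_mono_indicator:
  assumes "\<And>v. v \<in> \<Union>E \<Longrightarrow> \<phi> v = of_bool (P v)"
  shows "expected_mono \<phi> E = real (card {i. i < m \<and> (\<forall>v\<in>set (es ! i). P v)})"
proof -
  define Q where "Q e \<longleftrightarrow> (\<forall>v\<in>e. P v)" for e
  have prod: "(\<Prod>v\<in>e. \<phi> v) = of_bool (Q e)" if "e \<in> E" for e
  proof -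
    have "(\<Prod>v\<in>e. \<phi> v) = (\<Prod>v\<in>e. of_bool (P v))" using that by (intro prod.cong assms) auto
    also have "finite e" using that by auto
    then have "(\<Prod>v\<in>e. of_bool (P v)) = (of_bool (Q e) :: real)"
      unfolding Q_def by (induction e rule: finite_induct) auto
    finally show ?thesis .
  qed
  have "expected_mono \<phi> E = (\<Sum>e\<in>E. of_bool (Q e))"
    unfolding expected_mono_def using prod by (intro sum.cong) auto
  also have "\<dots> = (\<Sum>i<m. of_bool (Q (set (es ! i))))"
    by (rule sum.reindex_bij_betw[OF bij_edges, symmetric])
  also have "\<dots> = real (card ({..<m} \<inter> {i. Q (set (es ! i))}))" by simp
  also have "{..<m} \<inter> {i. Q (set (es ! i))} = {i. i < m \<and> Q (set (es ! i))}" by auto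
  finally show ?thesis unfolding Q_def .
qed

text \<open>Lets the program read the colour of a hyperedge off its weights. As
  \<open>length e \<le> r\<close>, no vertex is left out of the product.\<close>

lemma edge_weight_pos:
  assumes "D > 0" "length e \<le> r"
  shows "edge_weight r D h e > 0 \<longleftrightarrow> (\<forall>v\<in>set e. h v > 0)"
proof -
  have "edge_weight r D h e > 0 \<longleftrightarrow> (\<forall>j<r. 0 < (if j < length e then h (e ! j) else D))"
    unfolding edge_weight_def by (simp add: prod_pos_nat_iff Ball_def)
  also have "\<dots> \<longleftrightarrow> (\<forall>j<length e. h (e ! j) > 0)"
  proof (intro iffI allI impI)
    fix j assume "\<forall>j<r. 0 < (if j < length e then h (e ! j) else D)" "j < length e"
    then show "0 < h (e ! j)" using assms(2) by (auto dest!: spec[of _ j])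
  qed (use assms(1) in auto)
  also have "\<dots> \<longleftrightarrow> (\<forall>v\<in>set e. h v > 0)" by (simp add: all_set_conv_all_nth)
  finally show ?thesis .
qed

text \<open>The error collects the square root once per colour, \<open>r\<close> from rounding the
  probability, 1 from the empty hyperedge and 1/2 from odd \<open>m\<close>.\<close>

lemma separator_correct:
  assumes "r > 0" and cover: "\<Union>E \<subseteq> set xs" and deg: "\<And>v. real (vdegree E v) \<le> d"
  defines "R \<equiv> (\<lambda>i. set (es ! i)) ` set (separator r es xs)"
  shows "balanced_separator V E R \<and>
    real (card R) \<le> (1 / 2 - eps r) * real m + (2 * sqrt (d * real r * real m) + real r + 2)"
proof -
  have "0 \<le> real (vdegree E undefined)" by simp
  then have d: "0 \<le> d" using deg by (rule order_trans)
  show ?thesis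
  proof (cases "m = 0")
    case True
    show ?thesis
      using True by (simp add: R_def separator_def balanced_separator_def)
  next
    case False
    then have m: "m > 0" by simp
    define c where "c = colouring r es xs"
    define p where "p = real (bias r es) / m"
    define red where "red i \<longleftrightarrow> 0 < red_weight r es (bias r es) c i" for i
    define blue where "blue i \<longleftrightarrow> red_weight r es (bias r es) c i = 0 \<and> 0 < blue_weight r es (bias r es) c i" for i
    define K where "K Q = (\<lambda>i. set (es ! i)) ` {i. i < m \<and> among_first m Q i}" for Q
    have cardK: "card (K Q) = min (card {i. i < m \<and> Q i}) (m div 2)" for Q
      unfolding K_def card_among_first[symmetric]
      by (rule card_image) (auto intro: inj_on_subset[OF inj_edges])
    have KE: "K Q \<subseteq> E" for Q unfolding K_def by auto
    have "set (separator r es xs) = {..<m} - ({i. i < m \<and> among_first m red i} \<union> {i. i < m \<and> among_first m blue i})"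
      unfolding separator_def Let_def c_def[symmetric] kept_def red_def blue_def by auto
    then have R: "R = E - (K red \<union> K blue)"
      unfolding R_def K_def image_Un[symmetric] bij_betw_imp_surj_on[OF bij_edges, symmetric]
      by (simp only:) (rule inj_on_image_set_diff[OF inj_edges], auto)
    note dev = colouring_deviation[OF m, of xs, folded c_def]
    \<comment> \<open>\<open>xs\<close> covers all vertices of hyperedges, so none of these remains
      undecided and the expectations below are actual counts.\<close>
    have coloured': "c v = 1 \<or> c v = 2" if "v \<in> \<Union>E" for v
    proof -
      have "v \<in> set xs" using cover that by blast
      then show ?thesis using dev(2,3)[of v] by (auto simp: le_Suc_eq numeral_2_eq_2)
    qed
    then have coloured: "c v = 1 \<or> c v = 2" if "i < m" "v \<in> set (es ! i)" for i v
      using that coloured'[of v] nth_mem[of i es] by blast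
    have red: "red i \<longleftrightarrow> (\<forall>v\<in>set (es ! i). c v = 1)" if "i < m" for i
    proof -
      have "red i \<longleftrightarrow> (\<forall>v\<in>set (es ! i). 0 < red_factor m (bias r es) (c v))"
        unfolding red_def red_weight_def using that edges m by (intro edge_weight_pos) auto
      moreover have "0 < red_factor m (bias r es) (c v) \<longleftrightarrow> c v = 1" if "v \<in> set (es ! i)" for v
        using coloured[OF \<open>i < m\<close> that] m by (auto simp: red_factor_def)
      ultimately show ?thesis by simp
    qed
    have blue: "blue i \<longleftrightarrow> \<not> red i \<and> (\<forall>v\<in>set (es ! i). c v \<noteq> 1)" if "i < m" for i
    proof -
      have "0 < blue_weight r es (bias r es) c i \<longleftrightarrow> (\<forall>v\<in>set (es ! i). 0 < blue_factor m (bias r es) (c v))"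
        unfolding blue_weight_def using that edges m by (intro edge_weight_pos) auto
      moreover have "0 < blue_factor m (bias r es) (c v) \<longleftrightarrow> c v \<noteq> 1" if "v \<in> set (es ! i)" for v
        using coloured[OF \<open>i < m\<close> that] m by (auto simp: blue_factor_def)
      ultimately show ?thesis by (simp add: red_def blue_def)
    qed
    have disj: "K red \<inter> K blue = {}"
      unfolding K_def using inj_edges blue by (auto simp: inj_on_def among_first_def)
    have bal: "balanced_separator V E R"
      unfolding R
    proof (rule balanced_separator_two_colours[where P = "\<lambda>v. c v = 1"])
      show "\<forall>e\<in>K red. \<forall>v\<in>e. c v = 1" unfolding K_def by (auto simp: red among_first_def)
      show "\<forall>e\<in>K blue. \<forall>v\<in>e. c v \<noteq> 1" unfolding K_def by (auto simp: blue among_first_def)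
    qed (use KE in \<open>auto simp: cardK card_E\<close>)
    define \<delta> where "\<delta> = sqrt (d * real r * real m)"
    have \<delta>: "0 \<le> \<delta>" unfolding \<delta>_def using d by simp
    have "(\<Sum>v\<in>set xs. (real (vdegree E v))\<^sup>2) \<le> d * real r * real m"
      by (rule sum_vdegree_square) (use deg in auto)
    then have dev': "deviation c \<le> \<delta>\<^sup>2" unfolding \<delta>_def using dev(1) d by simp
    \<comment> \<open>Applied to each of the two differences whose squares add up to
      \<open>deviation c\<close>.\<close>
    have close: "\<bar>x\<bar> \<le> \<delta>" if "x\<^sup>2 \<le> deviation c" for x
      by (rule abs_le_square_iff[THEN iffD2, of x \<delta>, simplified \<delta> abs_of_nonneg[OF \<delta>]])
        (use that dev' in linarith)
    have "expected_mono (\<lambda>v. red_prob p (c v)) E = real (card {i. i < m \<and> (\<forall>v\<in>set (es ! i). c v = 1)})"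
      by (rule expected_mono_indicator) (use coloured' in \<open>fastforce simp: red_prob_def\<close>)
    also have "{i. i < m \<and> (\<forall>v\<in>set (es ! i). c v = 1)} = {i. i < m \<and> red i}" using red by auto
    finally have "real (card {i. i < m \<and> red i}) \<ge> expected_mono (\<lambda>_. p) E - \<delta>"
      using close[of "expected_mono (\<lambda>v. red_prob p (c v)) E - expected_mono (\<lambda>_. p) E"]
      by (simp add: deviation_def p_def)
    then have nred: "real (card {i. i < m \<and> red i}) \<ge> real m / 2 - \<delta>"
      using expected_red_ge[OF m] by (simp add: p_def)
    let ?B = "{i. i < m \<and> (\<forall>v\<in>set (es ! i). c v \<noteq> 1)}"
    have "expected_mono (\<lambda>v. 1 - red_prob p (c v)) E = real (card ?B)"
      by (rule expected_mono_indicator) (use coloured' in \<open>fastforce simp: red_prob_def\<close>)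
    then have "real (card ?B) \<ge> expected_mono (\<lambda>_. 1 - p) E - \<delta>"
      using close[of "expected_mono (\<lambda>v. 1 - red_prob p (c v)) E - expected_mono (\<lambda>_. 1 - p) E"]
      by (simp add: deviation_def p_def)
    \<comment> \<open>Only the empty hyperedge is without red vertices and yet counted as red, and
      it occurs at most once.\<close>
    moreover have "card ?B \<le> card {i. i < m \<and> blue i} + 1"
    proof -
      have "card ?B \<le> card ({i. i < m \<and> blue i} \<union> {i. i < m \<and> set (es ! i) = {}})"
        by (rule card_mono) (auto simp: blue red)
      also have "\<dots> \<le> card {i. i < m \<and> blue i} + card {i. i < m \<and> set (es ! i) = {}}"
        by (rule card_Un_le)
      also have "card {i. i < m \<and> set (es ! i) = {}} \<le> 1"
        using inj_edges by (auto simp: card_le_Suc0_iff_eq inj_on_def simp del: set_empty)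
      finally show ?thesis by simp
    qed
    ultimately have nblue: "real (card {i. i < m \<and> blue i}) \<ge> eps r * real m - real r - \<delta> - 1"
      using expected_blue_ge[OF m assms(1)] by (simp add: p_def)
    have "card R = card E - card (K red \<union> K blue)"
      unfolding R using KE by (intro card_Diff_subset) (auto intro: finite_subset[OF KE])
    also have "card (K red \<union> K blue) = card (K red) + card (K blue)"
      by (rule card_Un_disjoint) (use disj in \<open>auto simp: K_def\<close>)
    finally have cR: "card R = m - (card (K red) + card (K blue))" by (simp add: card_E)
    have "real (card R) = real m - real (card (K red)) - real (card (K blue))"
      unfolding cR cardK by (subst of_nat_diff) auto
    moreover have "real m \<le> real (2 * (m div 2) + 1)" unfolding of_nat_le_iff by simp
    then have half: "real (m div 2) \<ge> (real m - 1) / 2" by simp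
    then have "real (card (K red)) \<ge> real m / 2 - \<delta> - 1 / 2"
      unfolding cardK using nred \<delta> by (auto simp: min_def)
    \<comment> \<open>The cap \<open>m div 2\<close> is itself above the blue lower bound, so the
      minimum in \<open>cardK\<close> does no harm.\<close>
    moreover have "eps r * real m \<le> real m / 2"
      using mult_right_mono[OF eps_le_half[OF assms(1)], of "real m"] by simp
    then have "real (card (K blue)) \<ge> eps r * real m - real r - \<delta> - 1"
      unfolding cardK using nblue \<delta> half by (auto simp: min_def)
    ultimately show ?thesis
      using bal unfolding \<delta>_def[symmetric] by (simp add: algebra_simps)
  qed
qed

end

section \<open>Reasoning about programs\<close>

text \<open>Only coin-free runs are covered: the coin sequence has to be left untouched.\<close>

definition reach :: "com \<Rightarrow> nat \<Rightarrow> mem \<Rightarrow> (mem \<Rightarrow> bool) \<Rightarrow> bool" where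
  "reach c T M Q \<longleftrightarrow> (\<exists>t M'. t \<le> T \<and> (\<forall>\<omega>. exec c M \<omega> t M' \<omega>) \<and> Q M')"

fun banks :: "com \<Rightarrow> string set" where
  "banks Skip = {}"
| "banks (Assign x a b) = {x}"
| "banks (Flip x a) = {x}"
| "banks (Seq c d) = banks c \<union> banks d"
| "banks (Cond b c d) = banks c \<union> banks d"
| "banks (While b c) = banks c"

lemma exec_frame: "exec c M \<omega> t M' \<omega>' \<Longrightarrow> y \<notin> banks c \<Longrightarrow> M' y = M y"
  by (induction rule: exec.induct) (auto simp: upd_def)

lemma upd_apply: "upd M x i n y = (if y = x then (M x)(i := n) else M y)"
  by (simp add: upd_def)

lemma reach_mono: "reach c T M P \<Longrightarrow> T \<le> T' \<Longrightarrow> (\<And>M'. P M' \<Longrightarrow> Q M') \<Longrightarrow> reach c T' M Q"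
  unfolding reach_def by (meson order_trans)

lemma reach_frame: "reach c T M P \<Longrightarrow> reach c T M (\<lambda>M'. P M' \<and> (\<forall>y. y \<notin> banks c \<longrightarrow> M' y = M y))"
  unfolding reach_def using exec_frame by blast

lemma reach_Skip: "Q M \<Longrightarrow> reach Skip 1 M Q"
  unfolding reach_def using exec.Skip by blast

lemma reach_Assign: "Q (upd M x (aval a M) (aval b M)) \<Longrightarrow> reach (Assign x a b) 1 M Q"
  unfolding reach_def using exec.Assign by blast

text \<open>The continuation also learns which banks \<open>c\<close> left alone, so intermediate
  assertions need to mention only what changed.\<close>

lemma reach_Seq:
  assumes "reach c T M P"
    and "\<And>M'. P M' \<Longrightarrow> (\<And>y. y \<notin> banks c \<Longrightarrow> M' y = M y) \<Longrightarrow> reach d T' M' Q"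
  shows "reach (Seq c d) (T + T') M Q"
proof -
  obtain t M' where 1: "t \<le> T" "\<forall>\<omega>. exec c M \<omega> t M' \<omega>" "P M'" "\<And>y. y \<notin> banks c \<Longrightarrow> M' y = M y"
    using reach_frame[OF assms(1)] unfolding reach_def by blast
  then obtain t' M'' where "t' \<le> T'" "\<forall>\<omega>. exec d M' \<omega> t' M'' \<omega>" "Q M''"
    using assms(2)[of M'] unfolding reach_def by blast
  with 1 show ?thesis unfolding reach_def by (meson add_mono exec.Seq)
qed

lemma reach_Seq_Assign:
  "reach d T (upd M x (aval a M) (aval b M)) Q \<Longrightarrow> reach (Seq (Assign x a b) d) (1 + T) M Q"
  by (rule reach_Seq[OF reach_Assign]) auto

text \<open>Adding the bounds of the branches instead of taking the maximum keeps all time bounds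
  polynomial expressions.\<close>

lemma reach_Cond:
  assumes "bval b M \<Longrightarrow> reach c T M Q" "\<not> bval b M \<Longrightarrow> reach d T' M Q"
  shows "reach (Cond b c d) (T + T' + 1) M Q"
proof (cases "bval b M")
  case True
  then obtain t M' where 1: "t \<le> T" "\<forall>\<omega>. exec c M \<omega> t M' \<omega>" "Q M'"
    using assms unfolding reach_def by blast
  then have "\<forall>\<omega>. exec (Cond b c d) M \<omega> (t + 1) M' \<omega>" using True by (blast intro: exec.CondTrue)
  then show ?thesis unfolding reach_def using 1 by (intro exI[of _ "t + 1"] exI[of _ M']) auto
next
  case False
  then obtain t M' where 1: "t \<le> T'" "\<forall>\<omega>. exec d M \<omega> t M' \<omega>" "Q M'"
    using assms unfolding reach_def by blast
  then have "\<forall>\<omega>. exec (Cond b c d) M \<omega> (t + 1) M' \<omega>" using False by (blast intro: exec.CondFalse)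
  then show ?thesis unfolding reach_def using 1 by (intro exI[of _ "t + 1"] exI[of _ M']) auto
qed

text \<open>For loops with a known number \<open>N\<close> of rounds: the invariant is indexed by
  the rounds done, and the induction is on the rounds left. Each round pays 1 for its test, and the
  failing test pays the last 1.\<close>

lemma reach_While:
  assumes init: "I 0 M"
    and test: "\<And>k M'. k \<le> N \<Longrightarrow> I k M' \<Longrightarrow> (\<And>y. y \<notin> banks c \<Longrightarrow> M' y = M y) \<Longrightarrow> bval b M' \<longleftrightarrow> k < N"
    and body: "\<And>k M'. k < N \<Longrightarrow> I k M' \<Longrightarrow> (\<And>y. y \<notin> banks c \<Longrightarrow> M' y = M y) \<Longrightarrow> reach c T M' (I (Suc k))"
  shows "reach (While b c) (N * (T + 1) + 1) M (I N)"
proof -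
  have "reach (While b c) ((N - k) * (T + 1) + 1) M' (I N)"
    if "k \<le> N" "I k M'" "\<And>y. y \<notin> banks c \<Longrightarrow> M' y = M y" for k M'
    using that
  proof (induction "N - k" arbitrary: k M')
    case 0
    then have "k = N" "\<not> bval b M'" using test[of k M'] by auto
    then have "\<forall>\<omega>. exec (While b c) M' \<omega> 1 M' \<omega>" by (blast intro: exec.WhileFalse)
    then show ?case unfolding reach_def using 0 \<open>k = N\<close> by (intro exI[of _ 1] exI[of _ M']) auto
  next
    case (Suc l)
    then have b: "k < N" "bval b M'" using test[of k M'] by auto
    obtain t M1 where 1: "t \<le> T" "\<forall>\<omega>. exec c M' \<omega> t M1 \<omega>" "I (Suc k) M1"
      "\<And>y. y \<notin> banks c \<Longrightarrow> M1 y = M' y"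
      using reach_frame[OF body[of k M']] Suc.prems b unfolding reach_def by blast
    have "reach (While b c) ((N - Suc k) * (T + 1) + 1) M1 (I N)"
      using Suc.hyps(1)[of "Suc k" M1] Suc.hyps(2) Suc.prems b 1 by auto
    then obtain t' M2 where 2: "t' \<le> (N - Suc k) * (T + 1) + 1"
      "\<forall>\<omega>. exec (While b c) M1 \<omega> t' M2 \<omega>" "I N M2" unfolding reach_def by blast
    have "\<forall>\<omega>. exec (While b c) M' \<omega> (t + t' + 1) M2 \<omega>" using 1 2 b by (blast intro: exec.WhileTrue)
    moreover have "N - k = Suc (N - Suc k)" using b by simp
    then have "t + t' + 1 \<le> (N - k) * (T + 1) + 1" using 1 2 by simp
    ultimately show ?case unfolding reach_def using 2 by blast
  qed
  from this[of 0 M] init show ?thesis by simp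
qed

section \<open>The program\<close>

abbreviation seq (infixr ";;" 60) where "c ;; d \<equiv> Seq c d"
abbreviation var where "var x \<equiv> Cell x (Num 0)"
abbreviation set_var (infix "::=" 62) where "x ::= a \<equiv> Assign x (Num 0) a"
abbreviation "edge_count \<equiv> Cell ''in'' (Num 1)"
abbreviation "edge_size \<equiv> Cell ''in'' (Cell ''pos'' (var ''e''))"
abbreviation "edge_vertex \<equiv> Cell ''in'' (Plus (Plus (Cell ''pos'' (var ''e'')) (Num 1)) (var ''j''))"
abbreviation "incr x \<equiv> x ::= Plus (var x) (Num 1)"

text \<open>Repeated addition replaces the missing multiplication. The time is linear in the value
  of \<open>f\<close>, so \<open>f\<close> has to hold the polynomially bounded factor.\<close>

definition multiply :: "string \<Rightarrow> string \<Rightarrow> com" where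
  "multiply z f = ''t'' ::= Num 0;; ''i'' ::= Num 0;;
     While (Less (var ''i'') (var f)) (''t'' ::= Plus (var ''t'') (var z);; incr ''i'');;
     z ::= var ''t''"

definition pick_factors :: com where
  "pick_factors =
     Cond (Less (var ''j'') edge_size)
       (Cond (Less (Cell ''col'' edge_vertex) (Num 1))
          (''f'' ::= var ''a'';; ''g'' ::= Minus edge_count (var ''a''))
          (Cond (Less (Cell ''col'' edge_vertex) (Num 2))
             (''f'' ::= edge_count;; ''g'' ::= Num 0)
             (''f'' ::= Num 0;; ''g'' ::= edge_count)))
       (''f'' ::= edge_count;; ''g'' ::= edge_count)"

definition weigh :: "nat \<Rightarrow> com" where
  "weigh r = ''x'' ::= Num 1;; ''y'' ::= Num 1;; ''j'' ::= Num 0;;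
     While (Less (var ''j'') (Num r))
       (pick_factors;; multiply ''x'' ''f'';; multiply ''y'' ''g'';; incr ''j'')"

definition add_up :: "nat \<Rightarrow> com" where
  "add_up r = ''X'' ::= Num 0;; ''Y'' ::= Num 0;; ''e'' ::= Num 0;;
     While (Less (var ''e'') edge_count)
       (weigh r;; ''X'' ::= Plus (var ''X'') (var ''x'');; ''Y'' ::= Plus (var ''Y'') (var ''y'');;
        incr ''e'')"

abbreviation "gap x y \<equiv> Plus (Minus (var x) (var y)) (Minus (var y) (var x))"

definition measure_imbalance :: "nat \<Rightarrow> com" where
  "measure_imbalance r = add_up r;;
     ''F'' ::= gap ''X'' ''X0'';; ''d'' ::= gap ''X'' ''X0'';; multiply ''F'' ''d'';;
     ''G'' ::= gap ''Y'' ''Y0'';; ''d'' ::= gap ''Y'' ''Y0'';; multiply ''G'' ''d'';;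
     ''F'' ::= Plus (var ''F'') (var ''G'')"

text \<open>The first two input cells hold the numbers of vertices and of hyperedges, so the
  hyperedges start at 2. At the end \<open>l\<close> is the length of the input, the loop bound of
  \<open>colour_all\<close>.\<close>

definition locate_edges :: com where
  "locate_edges = ''l'' ::= Num 2;; ''e'' ::= Num 0;;
     While (Less (var ''e'') edge_count)
       (Assign ''pos'' (var ''e'') (var ''l'');;
        ''l'' ::= Plus (Plus (var ''l'') (Num 1)) (Cell ''in'' (var ''l''));;
        incr ''e'')"

text \<open>Linear search for the least \<open>a\<close>, while all colours are still 0.
  \<open>Z\<close> is the total for the full probability; \<open>X0\<close> and \<open>Y0\<close>
  record the initial expectations that the colouring has to stay close to.\<close>

definition find_bias :: "nat \<Rightarrow> com" where
  "find_bias r = ''a'' ::= edge_count;; add_up r;; ''Z'' ::= var ''X'';;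
     ''a'' ::= Num 0;; add_up r;;
     While (Less (Plus (var ''X'') (var ''X'')) (var ''Z'')) (incr ''a'';; add_up r);;
     ''X0'' ::= var ''X'';; ''Y0'' ::= var ''Y''"

abbreviation "current \<equiv> Cell ''in'' (var ''n'')"

text \<open>Both colours are tried in place, red first. Blue then stands unless red gave a strictly
  smaller imbalance.\<close>

definition colour_all :: "nat \<Rightarrow> com" where
  "colour_all r = ''n'' ::= Num 0;;
     While (Less (var ''n'') (var ''l''))
       (Cond (Less (Cell ''col'' current) (Num 1))
          (Assign ''col'' current (Num 1);; measure_imbalance r;; ''H'' ::= var ''F'';;
           Assign ''col'' current (Num 2);; measure_imbalance r;;
           Cond (Less (var ''H'') (var ''F'')) (Assign ''col'' current (Num 1)) Skip)
          Skip;;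
        incr ''n'')"

text \<open>\<open>p\<close> and \<open>q\<close> are twice the numbers of red and blue hyperedges
  met so far, the current one included; comparing them with the number of hyperedges plus 1 is the
  test in \<open>among_first\<close>. \<open>s\<close> flags a hyperedge that is kept.\<close>

definition select :: "nat \<Rightarrow> com" where
  "select r = ''p'' ::= Num 0;; ''q'' ::= Num 0;; ''e'' ::= Num 0;;
     While (Less (var ''e'') edge_count)
       (weigh r;; ''s'' ::= Num 0;;
        Cond (Less (Num 0) (var ''x''))
          (''p'' ::= Plus (var ''p'') (Num 2);;
           Cond (Less (var ''p'') (Plus edge_count (Num 1))) (''s'' ::= Num 1) Skip)
          (Cond (Less (Num 0) (var ''y''))
             (''q'' ::= Plus (var ''q'') (Num 2);;
              Cond (Less (var ''q'') (Plus edge_count (Num 1))) (''s'' ::= Num 1) Skip)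
             Skip);;
        Cond (Less (var ''s'') (Num 1))
          (incr ''out'';; Assign ''out'' (var ''out'') (var ''e''))
          Skip;;
        incr ''e'')"

definition separator_program :: "nat \<Rightarrow> com" where
  "separator_program r = locate_edges;; find_bias r;; colour_all r;; select r"

lemma banks_multiply [simp]: "banks (multiply z f) = {''t'', ''i'', z}"
  by (auto simp: multiply_def)
lemma banks_pick [simp]: "banks pick_factors = {''f'', ''g''}"
  by (auto simp: pick_factors_def)
lemma banks_weigh [simp]: "banks (weigh r) = {''x'', ''y'', ''j'', ''f'', ''g'', ''t'', ''i''}"
  by (auto simp: weigh_def)
lemma banks_add_up [simp]: "banks (add_up r) = {''X'', ''Y'', ''e''} \<union> banks (weigh r)"
  by (auto simp: add_up_def)
lemma banks_measure_imbalance [simp]: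
  "banks (measure_imbalance r) = {''F'', ''G'', ''d''} \<union> banks (add_up r)"
  by (auto simp: measure_imbalance_def)

lemma coin_free_separator_program: "coin_free (separator_program r)"
  by (simp add: separator_program_def locate_edges_def find_bias_def colour_all_def select_def
      measure_imbalance_def add_up_def weigh_def pick_factors_def multiply_def)

section \<open>Correctness and step counts of the subprograms\<close>

lemma reach_multiply:
  assumes "z \<noteq> ''t''" "z \<noteq> ''i''" "f \<noteq> ''t''" "f \<noteq> ''i''" "M f 0 \<le> b"
  shows "reach (multiply z f) (3 * b + 4) M (\<lambda>M'. M' z 0 = M z 0 * M f 0)"
proof -
  let ?I = "\<lambda>k M'. M' ''i'' 0 = k \<and> M' ''t'' 0 = M z 0 * k \<and> M' z = M z \<and> M' f = M f"
  have "reach (multiply z f) (1 + (1 + ((M f 0 * ((1 + 1) + 1) + 1) + 1))) M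
      (\<lambda>M'. M' z 0 = M z 0 * M f 0)"
    unfolding multiply_def
  proof (intro reach_Seq_Assign, rule reach_Seq[where P = "?I (M f 0)"], goal_cases)
    case 1
    show ?case
    proof (rule reach_While, goal_cases)
      case 1
      then show ?case using assms by (simp add: upd_apply)
    next
      case (2 k M')
      then show ?case using assms by simp
    next
      case (3 k M')
      show ?case
        by (intro reach_Seq_Assign reach_Assign) (use 3 assms in \<open>simp add: upd_apply\<close>)
    qed
  next
    case (2 M')
    then show ?case by (intro reach_Assign) (simp add: upd_apply)
  qed
  then show ?thesis by (rule reach_mono) (use assms in auto)
qed

definition stored :: "nat list list \<Rightarrow> mem \<Rightarrow> bool" where
  "stored es M \<longleftrightarrow> M ''in'' 1 = length es \<and>
     (\<forall>i<length es. M ''in'' (M ''pos'' i) = length (es ! i) \<and>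
        (\<forall>j<length (es ! i). M ''in'' (M ''pos'' i + 1 + j) = es ! i ! j))"

lemma stored_cong: "stored es M \<Longrightarrow> M' ''in'' = M ''in'' \<Longrightarrow> M' ''pos'' = M ''pos'' \<Longrightarrow> stored es M'"
  by (simp add: stored_def)

lemma reach_pick_factors:
  assumes "stored es M" "M ''e'' 0 < length es"
  shows "reach pick_factors 11 M (\<lambda>M'.
    M' ''f'' 0 = (if M ''j'' 0 < length (es ! M ''e'' 0)
       then red_factor (length es) (M ''a'' 0) (M ''col'' (es ! M ''e'' 0 ! M ''j'' 0)) else length es) \<and>
    M' ''g'' 0 = (if M ''j'' 0 < length (es ! M ''e'' 0)
       then blue_factor (length es) (M ''a'' 0) (M ''col'' (es ! M ''e'' 0 ! M ''j'' 0)) else length es))"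
  (is "reach _ _ _ ?Q")
proof -
  have "reach pick_factors (((1 + 1) + ((1 + 1) + (1 + 1) + 1) + 1) + (1 + 1) + 1) M ?Q"
    unfolding pick_factors_def
    by (intro reach_Cond reach_Seq_Assign reach_Assign)
      (use assms in \<open>auto simp: stored_def upd_apply red_factor_def blue_factor_def\<close>)
  then show ?thesis by (rule reach_mono) auto
qed

lemma red_factor_le: "a \<le> D \<Longrightarrow> red_factor D a c \<le> D"
  by (simp add: red_factor_def)

lemma blue_factor_le: "blue_factor D a c \<le> D"
  by (simp add: blue_factor_def)

text \<open>This and the later time bounds have the shape in which the \<open>reach\<close> rules
  assemble them, so the rules apply without arithmetic.\<close>

definition weigh_time :: "nat \<Rightarrow> nat \<Rightarrow> nat" where
  "weigh_time r m = 1 + (1 + (1 + (r * ((11 + ((3 * m + 4) + ((3 * m + 4) + 1))) + 1) + 1)))"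

lemma reach_weigh:
  assumes "stored es M" "M ''e'' 0 < length es" "M ''a'' 0 \<le> length es"
  shows "reach (weigh r) (weigh_time r (length es)) M (\<lambda>M'.
    M' ''x'' 0 = red_weight r es (M ''a'' 0) (M ''col'') (M ''e'' 0) \<and>
    M' ''y'' 0 = blue_weight r es (M ''a'' 0) (M ''col'') (M ''e'' 0))"
proof -
  let ?m = "length es" and ?e = "es ! M ''e'' 0"
  let ?f = "\<lambda>j. if j < length ?e then red_factor ?m (M ''a'' 0) (M ''col'' (?e ! j)) else ?m"
  let ?g = "\<lambda>j. if j < length ?e then blue_factor ?m (M ''a'' 0) (M ''col'' (?e ! j)) else ?m"
  let ?I = "\<lambda>k M'. M' ''j'' 0 = k \<and> M' ''x'' 0 = prod ?f {..<k} \<and> M' ''y'' 0 = prod ?g {..<k}"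
  have "reach (weigh r) (weigh_time r ?m) M (?I r)"
    unfolding weigh_def weigh_time_def
  proof (intro reach_Seq_Assign, rule reach_While, goal_cases)
    case 1
    show ?case by (simp add: upd_apply)
  next
    case (2 k M')
    then show ?case by simp
  next
    case (3 k M0)
    have frame: "M0 y = M y" if "y \<notin> {''x'', ''y'', ''j'', ''f'', ''g'', ''t'', ''i''}" for y
      using 3(3)[of y] that by (simp add: upd_apply)
    have st: "stored es M0" by (rule stored_cong[OF assms(1)]) (simp_all add: frame)
    show ?case
    proof (rule reach_Seq[OF reach_pick_factors[OF st]], goal_cases)
      case (2 M1)
      have M1: "M1 ''f'' 0 = ?f k" "M1 ''g'' 0 = ?g k" using 2 \<open>?I k M0\<close> by (simp_all add: frame)
      have frame1: "M1 y = M0 y" if "y \<notin> {''f'', ''g''}" for y using 2 that by simp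
      show ?case
      proof (rule reach_Seq[OF reach_multiply[where b = ?m]], goal_cases)
        case 5
        show ?case using assms(3) by (auto simp: M1 red_factor_le)
      next
        case (6 M2)
        have frame2: "M2 y = M1 y" if "y \<notin> {''t'', ''i'', ''x''}" for y using 6 that by simp
        show ?case
        proof (rule reach_Seq[OF reach_multiply[where b = ?m]], goal_cases)
          case 5
          show ?case by (auto simp: frame2 M1 blue_factor_le)
        next
          case (6 M3)
          then have frame3: "M3 y = M2 y" if "y \<notin> {''t'', ''i'', ''y''}" for y using that by simp
          show ?case
            by (rule reach_Assign)
              (use \<open>M2 ''x'' 0 = _\<close> \<open>M3 ''y'' 0 = _\<close> \<open>?I k M0\<close> in
                \<open>simp add: upd_apply frame3 frame2 frame1 M1 del: prod.lessThan_Suc if_split, simp\<close>)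
        qed simp_all
      qed simp_all
    qed (use assms in \<open>simp_all add: frame\<close>)
  qed
  then show ?thesis
    by (rule reach_mono) (simp_all add: red_weight_def blue_weight_def edge_weight_def)
qed

definition add_time :: "nat \<Rightarrow> nat \<Rightarrow> nat" where
  "add_time r m = 1 + (1 + (1 + (m * ((weigh_time r m + (1 + (1 + 1))) + 1) + 1)))"

lemma reach_add_up:
  assumes "stored es M" "M ''a'' 0 \<le> length es"
  shows "reach (add_up r) (add_time r (length es)) M (\<lambda>M'.
    M' ''X'' 0 = red_total r es (M ''a'' 0) (M ''col'') \<and>
    M' ''Y'' 0 = blue_total r es (M ''a'' 0) (M ''col''))"
proof -
  let ?m = "length es"
  let ?I = "\<lambda>k M'. M' ''e'' 0 = k \<and> M' ''X'' 0 = sum (red_weight r es (M ''a'' 0) (M ''col'')) {..<k} \<and>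
    M' ''Y'' 0 = sum (blue_weight r es (M ''a'' 0) (M ''col'')) {..<k}"
  have "reach (add_up r) (add_time r ?m) M (?I ?m)"
    unfolding add_up_def add_time_def
  proof (intro reach_Seq_Assign, rule reach_While, goal_cases)
    case 1
    show ?case by (simp add: upd_apply)
  next
    case (2 k M0)
    have "M0 ''in'' = M ''in''" using 2(3)[of "''in''"] by (simp add: upd_apply)
    then show ?case using 2 assms(1) by (simp add: stored_def)
  next
    case (3 k M0)
    have frame: "M0 y = M y" if "y \<notin> banks (add_up r)" for y
      using 3(3)[of y] that by (simp add: upd_apply)
    have st: "stored es M0" by (rule stored_cong[OF assms(1)]) (simp_all add: frame)
    show ?case
    proof (rule reach_Seq[OF reach_weigh[OF st]], goal_cases)
      case (3 M1)
      have frame1: "M1 y = M0 y" if "y \<notin> banks (weigh r)" for y using 3 that by blast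
      show ?case
        by (intro reach_Seq_Assign reach_Assign)
          (use 3 \<open>?I k M0\<close> in \<open>simp add: upd_apply frame1 frame\<close>)
    qed (use assms \<open>?I k M0\<close> \<open>k < ?m\<close> in \<open>simp_all add: frame\<close>)
  qed
  then show ?thesis by (rule reach_mono) (simp_all add: red_total_def blue_total_def)
qed

lemma edge_weight_le: "(\<And>v. h v \<le> D) \<Longrightarrow> edge_weight r D h e \<le> D ^ r"
  unfolding edge_weight_def using prod_mono[of "{..<r}" _ "\<lambda>_. D"] by auto

text \<open>Bounds the loop count when the imbalance is squared by repeated addition.\<close>

lemma red_total_le: "a \<le> length es \<Longrightarrow> red_total r es a c \<le> length es * length es ^ r"
  unfolding red_total_def red_weight_def
  by (rule order_trans[OF sum_mono[OF edge_weight_le]]) (auto simp: red_factor_le)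

lemma blue_total_le: "blue_total r es a c \<le> length es * length es ^ r"
  unfolding blue_total_def blue_weight_def
  by (rule order_trans[OF sum_mono[OF edge_weight_le]]) (auto simp: blue_factor_le)

definition imbalance_time :: "nat \<Rightarrow> nat \<Rightarrow> nat" where
  "imbalance_time r m = add_time r m +
     (1 + (1 + ((3 * (m * m ^ r) + 4) + (1 + (1 + ((3 * (m * m ^ r) + 4) + 1))))))"

lemma reach_measure_imbalance:
  assumes "stored es M" "M ''a'' 0 \<le> length es" "M ''X0'' 0 = red_total r es (M ''a'' 0) (\<lambda>_. 0)"
    "M ''Y0'' 0 = blue_total r es (M ''a'' 0) (\<lambda>_. 0)"
  shows "reach (measure_imbalance r) (imbalance_time r (length es)) M (\<lambda>M'.
    M' ''F'' 0 = imbalance r es (M ''a'' 0) (M ''col''))"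
proof -
  let ?m = "length es" and ?a = "M ''a'' 0"
  let ?X = "red_total r es ?a (M ''col'')" and ?Y = "blue_total r es ?a (M ''col'')"
  let ?Xs = "red_total r es ?a (\<lambda>_. 0)" and ?Ys = "blue_total r es ?a (\<lambda>_. 0)"
  show ?thesis
    unfolding measure_imbalance_def imbalance_time_def
  proof (rule reach_Seq[OF reach_add_up[OF assms(1,2)]], intro reach_Seq_Assign,
      rule reach_Seq[OF reach_multiply[where b = "?m * ?m ^ r"]], goal_cases)
    case (5 M1)
    then show ?case
      using red_total_le[OF assms(2), of r "M ''col''"] red_total_le[OF assms(2), of r "\<lambda>_. 0"] assms(3)
      by (simp add: upd_apply)
  next
    case (6 M1 M2)
    have frame1: "M1 y = M y" if "y \<notin> banks (add_up r)" for y using 6(2) that by blast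
    have frame2: "M2 y = M1 y" if "y \<notin> {''F'', ''d'', ''t'', ''i''}" for y
      using 6(4)[of y] that by (simp add: upd_apply)
    have F: "M2 ''F'' 0 = (distance ?X ?Xs)\<^sup>2"
      unfolding 6(3) using 6(1) assms(3)
      by (simp add: upd_apply frame1 distance_def power2_eq_square)
    show ?case
    proof (intro reach_Seq_Assign, rule reach_Seq[OF reach_multiply[where b = "?m * ?m ^ r"]], goal_cases)
      case 5
      show ?case
        using 6(1) blue_total_le[of r es ?a "M ''col''"] blue_total_le[of r es ?a "\<lambda>_. 0"] assms(4)
        by (simp add: upd_apply frame2 frame1)
    next
      case (6 M3)
      have frame3: "M3 y = M2 y" if "y \<notin> {''G'', ''d'', ''t'', ''i''}" for y
        using 6(2)[of y] that by (simp add: upd_apply)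
      have G: "M3 ''G'' 0 = (distance ?Y ?Ys)\<^sup>2"
        using 6(1) \<open>_ \<and> M1 ''Y'' 0 = _\<close> assms(4)
        by (simp add: upd_apply frame1 frame2 distance_def power2_eq_square)
      show ?case
        by (rule reach_Assign) (simp add: upd_apply frame3 F G imbalance_def)
    qed simp_all
  qed simp_all
qed

definition edge_start :: "nat list list \<Rightarrow> nat \<Rightarrow> nat" where
  "edge_start es i = 2 + length (concat (map (\<lambda>e. length e # e) (take i es)))"

lemma edge_start_Suc: "i < length es \<Longrightarrow> edge_start es (Suc i) = edge_start es i + 1 + length (es ! i)"
  by (simp add: edge_start_def take_Suc_conv_app_nth)

lemma edge_start_length: "edge_start es (length es) = length (encode n es)"
  by (simp add: edge_start_def encode_def)

text \<open>Splitting the encoding at hyperedge \<open>i\<close> isolates its block. Offset 0 is the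
  length cell, so \<open>j\<close> may equal the length of the hyperedge.\<close>

lemma encode_nth:
  assumes "i < length es" "j \<le> length (es ! i)"
  shows "edge_start es i + j < length (encode n es)"
    and "encode n es ! (edge_start es i + j) = (length (es ! i) # es ! i) ! j"
proof -
  have "concat (map (\<lambda>e. length e # e) es) = concat (map (\<lambda>e. length e # e) (take i es)) @
      (length (es ! i) # es ! i) @ concat (map (\<lambda>e. length e # e) (drop (Suc i) es))"
    by (subst id_take_nth_drop[OF assms(1)]) simp
  then show "edge_start es i + j < length (encode n es)"
    "encode n es ! (edge_start es i + j) = (length (es ! i) # es ! i) ! j"
    using assms(2) by (auto simp: edge_start_def encode_def nth_append nth_Cons split: nat.split)
qed

definition locate_time :: "nat \<Rightarrow> nat" where
  "locate_time m = 1 + (1 + (m * ((1 + (1 + 1)) + 1) + 1))"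

lemma reach_locate_edges:
  assumes "M ''in'' = input_mem (encode n es) ''in''"
  shows "reach locate_edges (locate_time (length es)) M
    (\<lambda>M'. stored es M' \<and> M' ''l'' 0 = length (encode n es))"
proof -
  let ?m = "length es"
  let ?I = "\<lambda>k M'. M' ''e'' 0 = k \<and> M' ''l'' 0 = edge_start es k \<and>
    (\<forall>i<k. M' ''pos'' i = edge_start es i) \<and> M' ''in'' = M ''in''"
  have nth: "M ''in'' (edge_start es i + j) = (length (es ! i) # es ! i) ! j"
    if "i < length es" "j \<le> length (es ! i)" for i j
    using encode_nth[OF that, of n] by (simp add: assms input_mem_def)
  have m: "M ''in'' (Suc 0) = length es" by (simp add: assms input_mem_def encode_def)
  have "reach locate_edges (locate_time ?m) M (?I ?m)"
    unfolding locate_edges_def locate_time_def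
  proof (intro reach_Seq_Assign, rule reach_While, goal_cases)
    case 1
    show ?case by (simp add: upd_apply edge_start_def)
  next
    case (2 k M')
    then show ?case by (simp add: m)
  next
    case (3 k M')
    show ?case
      by (intro reach_Seq_Assign reach_Assign)
        (use 3 nth[of k 0] in \<open>auto simp: upd_apply edge_start_Suc less_Suc_eq\<close>)
  qed
  then show ?thesis
  proof (rule reach_mono)
    fix M' assume *: "?I ?m M'"
    show "stored es M' \<and> M' ''l'' 0 = length (encode n es)"
      unfolding stored_def
      using * m nth[of _ 0] nth[of _ "Suc _"] by (simp add: edge_start_length[symmetric] Suc_le_eq)
  qed simp
qed

definition bias_time :: "nat \<Rightarrow> nat \<Rightarrow> nat" where
  "bias_time r m = 1 + (add_time r m + (1 + (1 + (add_time r m +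
     ((m * ((1 + add_time r m) + 1) + 1) + (1 + 1))))))"

lemma reach_find_bias:
  assumes "edge_list r es" "stored es M" "M ''col'' = (\<lambda>_. 0)"
  shows "reach (find_bias r) (bias_time r (length es)) M (\<lambda>M'.
    M' ''a'' 0 = bias r es \<and>
    M' ''X0'' 0 = red_total r es (bias r es) (\<lambda>_. 0) \<and>
    M' ''Y0'' 0 = blue_total r es (bias r es) (\<lambda>_. 0))"
proof -
  let ?m = "length es"
  let ?I = "\<lambda>k M'. M' ''a'' 0 = k \<and> M' ''X'' 0 = red_total r es k (\<lambda>_. 0) \<and>
    M' ''Y'' 0 = blue_total r es k (\<lambda>_. 0)"
  have m: "M ''in'' (Suc 0) = ?m" using assms(2) by (simp add: stored_def)
  note bias_le = edge_list.bias_le[OF assms(1)]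
  have add_up: "reach (add_up r) (add_time r ?m) M' (\<lambda>M''.
      M'' ''X'' 0 = red_total r es (M' ''a'' 0) (\<lambda>_. 0) \<and> M'' ''Y'' 0 = blue_total r es (M' ''a'' 0) (\<lambda>_. 0))"
    if "M' ''in'' = M ''in''" "M' ''pos'' = M ''pos''" "M' ''col'' = M ''col''" "M' ''a'' 0 \<le> ?m" for M'
    using reach_add_up[OF stored_cong[OF assms(2) that(1,2)] that(4), of r] by (simp add: that(3) assms(3))
  show ?thesis
    unfolding find_bias_def bias_time_def
  proof (rule reach_Seq_Assign, rule reach_Seq[OF add_up], goal_cases)
    case (5 M1)
    have frame1: "M1 y = M y" if "y \<notin> {''a''} \<union> banks (add_up r)" for y
      using 5(2)[of y] that by (simp add: upd_apply)
    show ?case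
    proof (intro reach_Seq_Assign, rule reach_Seq[OF add_up], goal_cases)
      case (5 M2)
      have frame2: "M2 y = M1 y" if "y \<notin> {''a'', ''Z''} \<union> banks (add_up r)" for y
        using 5(2)[of y] that by (simp add: upd_apply)
      have Z: "M2 ''Z'' 0 = red_total r es ?m (\<lambda>_. 0)"
        using 5(2)[of "''Z''"] \<open>M1 ''X'' 0 = _ \<and> _\<close> by (simp add: upd_apply m)
      have a: "M2 ''a'' 0 = 0" using 5(2)[of "''a''"] by (simp add: upd_apply)
      show ?case
      proof (rule reach_Seq[where P = "?I (bias r es)"], goal_cases)
        case 1
        have "reach (While (Less (Plus (var ''X'') (var ''X'')) (var ''Z'')) (incr ''a'';; add_up r))
          (bias r es * ((1 + add_time r ?m) + 1) + 1) M2 (?I (bias r es))"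
        proof (rule reach_While, goal_cases)
          case 1
          then show ?case using 5(1) a by (simp add: upd_apply)
        next
          case (2 k M3)
          \<comment> \<open>Minimality of \<open>bias\<close> keeps the test true before it is
            reached, and its defining property makes the test fail there.\<close>
          have "red_total r es k (\<lambda>_. 0) + red_total r es k (\<lambda>_. 0) < red_total r es ?m (\<lambda>_. 0) \<longleftrightarrow> k < bias r es"
            using edge_list.less_bias[OF assms(1), of k] edge_list.bias_works[OF assms(1)] 2(1)
            by (cases "k = bias r es") auto
          then show ?case using 2(2) 2(3)[of "''Z''"] by (simp add: Z)
        next
          case (3 k M3)
          have frame3: "M3 y = M2 y" if "y \<notin> {''a''} \<union> banks (add_up r)" for y using 3(3)[of y] that by simp
          show ?case
          proof (rule reach_Seq_Assign, rule reach_mono[OF reach_frame[OF add_up]], goal_cases)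
            case (6 M4)
            then show ?case using 3(2) by (simp add: upd_apply)
          qed (use 3 bias_le in \<open>simp_all add: upd_apply frame3 frame2 frame1\<close>)
        qed
        then show ?case by (rule reach_mono[OF _ add_mono[OF mult_le_mono1[OF bias_le] order_refl]])
      next
        case (2 M3)
        then show ?case
          by (intro reach_Seq_Assign reach_Assign) (simp add: upd_apply)
      qed
    qed (simp_all add: upd_apply frame1)
  qed (simp_all add: upd_apply m)
qed

definition colour_time :: "nat \<Rightarrow> nat \<Rightarrow> nat \<Rightarrow> nat" where
  "colour_time r m l = 1 + (l * (((1 + (imbalance_time r m + (1 + (1 + (imbalance_time r m + (1 + 1 + 1))))))
     + 1 + 1 + 1) + 1) + 1)"

lemma reach_colour_all:
  assumes "stored es M" "M ''col'' = (\<lambda>_. 0)" "M ''a'' 0 = bias r es" "bias r es \<le> length es"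
    "M ''X0'' 0 = red_total r es (bias r es) (\<lambda>_. 0)"
    "M ''Y0'' 0 = blue_total r es (bias r es) (\<lambda>_. 0)"
    and xs: "M ''l'' 0 = length xs" "\<And>i. i < length xs \<Longrightarrow> M ''in'' i = xs ! i"
  shows "reach (colour_all r) (colour_time r (length es) (length xs)) M (\<lambda>M'.
    M' ''col'' = colouring r es xs)"
proof -
  let ?step = "colour_vertex r es (bias r es)"
  let ?I = "\<lambda>k M'. M' ''n'' 0 = k \<and> M' ''col'' = fold ?step (take k xs) (\<lambda>_. 0)"
  have "reach (colour_all r) (colour_time r (length es) (length xs)) M (?I (length xs))"
    unfolding colour_all_def colour_time_def
  proof (rule reach_Seq_Assign, rule reach_While, goal_cases)
    case 1
    show ?case by (simp add: upd_apply assms)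
  next
    case (2 k M')
    then show ?case using 2(3)[of "''l''"] by (simp add: upd_apply xs)
  next
    case (3 k M0)
    have frame: "M0 y = M y" if "y \<notin> {''col'', ''n'', ''H''} \<union> banks (measure_imbalance r)" for y
      using 3(3)[of y] that by (simp add: upd_apply)
    let ?v = "xs ! k" and ?c = "M0 ''col''"
    let ?imb = "imbalance r es (bias r es)"
    have v: "M0 ''in'' k = ?v" using 3(1) by (simp add: frame xs)
    have n: "M0 ''n'' 0 = k" using 3(2) by simp
    \<comment> \<open>Stated for every memory that differs from \<open>M0\<close> only in colours
      and working banks, since it is needed after each trial colour.\<close>
    have measure: "reach (measure_imbalance r) (imbalance_time r (length es)) M'
        (\<lambda>M''. M'' ''F'' 0 = ?imb (M' ''col''))"
      if "\<And>y. y \<notin> {''col'', ''n'', ''H''} \<union> banks (measure_imbalance r) \<Longrightarrow> M' y = M0 y" for M'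
    proof -
      have "stored es M'" by (rule stored_cong[OF assms(1)]) (simp_all add: frame that)
      moreover have "M' y = M y" if "y \<in> {''a'', ''X0'', ''Y0''}" for y
        using \<open>\<And>y. y \<notin> _ \<Longrightarrow> M' y = M0 y\<close>[of y] frame[of y] that by auto
      ultimately show ?thesis using reach_measure_imbalance[of es M' r] assms by simp
    qed
    show ?case
    proof (rule reach_Seq[where P = "\<lambda>M1. M1 ''col'' = ?step ?v ?c"], goal_cases)
      case 1
      show ?case
      proof (rule reach_Cond, goal_cases)
        case 1
        then have cv: "?c ?v = 0" by (simp add: n v)
        show ?case
        proof (rule reach_Seq_Assign, rule reach_Seq[OF measure], goal_cases)
          case (1 y)
          then show ?case by (auto simp: upd_apply)
        next
          case (2 M1)
          have F1: "M1 ''F'' 0 = ?imb (?c(?v := 1))" using 2(1) by (simp add: upd_apply n v)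
          have frame1: "M1 y = M0 y" if "y \<notin> {''col''} \<union> banks (measure_imbalance r)" for y
            using 2(2)[of y] that by (simp add: upd_apply)
          have col1: "M1 ''col'' = ?c(?v := 1)" using 2(2)[of "''col''"] by (simp add: upd_apply n v)
          show ?case
          proof (intro reach_Seq_Assign, rule reach_Seq[OF measure], goal_cases)
            case (1 y)
            then show ?case by (auto simp: upd_apply frame1)
          next
            case (2 M2)
            have F2: "M2 ''F'' 0 = ?imb (?c(?v := 2))" using 2(1) by (simp add: upd_apply frame1 n v col1)
            have frame2: "M2 y = M0 y" if "y \<notin> {''col'', ''H''} \<union> banks (measure_imbalance r)" for y
              using 2(2)[of y] that by (simp add: upd_apply frame1)
            have col2: "M2 ''col'' = ?c(?v := 2)"
              using 2(2)[of "''col''"] by (simp add: upd_apply frame1 n v col1)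
            have H: "M2 ''H'' 0 = ?imb (?c(?v := 1))"
              using 2(2)[of "''H''"] by (simp add: upd_apply F1)
            show ?case
              by (intro reach_Cond reach_Assign reach_Skip)
                (simp_all add: upd_apply H F2 col2 frame2 n v colour_vertex_def cv)
          qed
        qed
      next
        case 2
        then show ?case by (intro reach_Skip) (simp add: n v colour_vertex_def)
      qed
    next
      case (2 M1)
      have "M1 ''n'' 0 = k" using 2(2)[of "''n''"] by (simp add: n)
      then show ?case
        by (intro reach_Assign) (use 2(1) 3(1,2) in \<open>simp add: upd_apply take_Suc_conv_app_nth\<close>)
    qed
  qed
  then show ?thesis by (rule reach_mono) (simp_all add: colouring_def)
qed

definition select_time :: "nat \<Rightarrow> nat \<Rightarrow> nat" where
  "select_time r m = 1 + (1 + (1 + (m * ((weigh_time r m + (1 +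
     (((1 + (1 + 1 + 1)) + ((1 + (1 + 1 + 1)) + 1 + 1) + 1) + (((1 + 1) + 1 + 1) + 1)))) + 1) + 1)))"

lemma card_below_Suc: "card {l. l < Suc k \<and> P l} = card {l. l < k \<and> P l} + of_bool (P k)"
proof -
  have "{l. l < Suc k \<and> P l} = (if P k then insert k {l. l < k \<and> P l} else {l. l < k \<and> P l})"
    by (auto simp: less_Suc_eq)
  then show ?thesis by simp
qed

lemma output_list_append:
  "output_list (upd (upd M ''out'' 0 (Suc (M ''out'' 0))) ''out'' (Suc (M ''out'' 0)) v) = output_list M @ [v]"
  by (auto simp: output_list_def upd_apply)

lemma reach_select:
  assumes "stored es M" "M ''a'' 0 = bias r es" "bias r es \<le> length es" "M ''out'' 0 = 0"
    "M ''col'' = colouring r es xs"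
  shows "reach (select r) (select_time r (length es)) M (\<lambda>M'. output_list M' = separator r es xs)"
proof -
  let ?m = "length es"
  let ?x = "red_weight r es (bias r es) (colouring r es xs)"
  let ?y = "blue_weight r es (bias r es) (colouring r es xs)"
  let ?P = "\<lambda>i. 0 < ?x i" and ?Q = "\<lambda>i. ?x i = 0 \<and> 0 < ?y i"
  let ?I = "\<lambda>k M'. M' ''e'' 0 = k \<and> M' ''p'' 0 = 2 * card {l. l < k \<and> ?P l} \<and>
    M' ''q'' 0 = 2 * card {l. l < k \<and> ?Q l} \<and>
    output_list M' = filter (\<lambda>i. \<not> kept ?m ?x ?y i) [0..<k]"
  have "reach (select r) (select_time r ?m) M (?I ?m)"
    unfolding select_def select_time_def
  proof (intro reach_Seq_Assign, rule reach_While[where I = ?I], goal_cases)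
    case 1
    show ?case by (simp add: upd_apply output_list_def assms)
  next
    case (2 k M0)
    have "M0 ''in'' = M ''in''" using 2(3)[of "''in''"] by (simp add: upd_apply)
    then show ?case using 2 assms(1) by (simp add: stored_def)
  next
    case (3 k M0)
    have frame: "M0 y = M y" if "y \<notin> {''p'', ''q'', ''e'', ''s'', ''out''} \<union> banks (weigh r)" for y
      using 3(3)[of y] that by (simp add: upd_apply)
    note I = 3(2)
    have st: "stored es M0" by (rule stored_cong[OF assms(1)]) (simp_all add: frame)
    then have m: "M0 ''in'' (Suc 0) = ?m" by (simp add: stored_def)
    show ?case
    proof (rule reach_Seq[OF reach_weigh[OF st]], goal_cases)
      case (3 M1)
      have frame1: "M1 y = M0 y" if "y \<notin> banks (weigh r)" for y using 3 that by blast
      have xy: "M1 ''x'' 0 = ?x k" "M1 ''y'' 0 = ?y k"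
        using 3(1) I by (simp_all add: frame assms)
      show ?case
      proof (rule reach_Seq_Assign, rule reach_Seq[where P = "\<lambda>M2.
          M2 ''p'' 0 = 2 * card {l. l < Suc k \<and> ?P l} \<and> M2 ''q'' 0 = 2 * card {l. l < Suc k \<and> ?Q l} \<and>
          M2 ''s'' 0 = of_bool (kept ?m ?x ?y k)"], goal_cases)
        case 1
        show ?case
          unfolding card_below_Suc
          by (intro reach_Cond reach_Seq_Assign reach_Assign reach_Skip)
            (use I in \<open>auto simp: upd_apply xy frame1 m kept_def among_first_def\<close>)
      next
        case (2 M2)
        have frame2: "M2 y = M1 y" if "y \<notin> {''p'', ''q'', ''s''}" for y
          using 2(2)[of y] that by (simp add: upd_apply)
        show ?case
        proof (rule reach_Seq[where P = "\<lambda>M3. output_list M3 = filter (\<lambda>i. \<not> kept ?m ?x ?y i) [0..<Suc k]"], goal_cases)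
          case 1
          have "output_list M2 = output_list M0" by (simp add: output_list_def frame2 frame1)
          then have out: "output_list M2 = filter (\<lambda>i. \<not> kept ?m ?x ?y i) [0..<k]" using I by simp
          have e: "M2 ''e'' 0 = k" using I by (simp add: frame2 frame1)
          show ?case
            by (intro reach_Cond reach_Seq_Assign reach_Assign reach_Skip)
              (use 2(1) out e in \<open>auto simp: upd_apply output_list_append split: if_splits\<close>)
        next
          case (2 M3)
          have "M3 y = M2 y" if "y \<notin> {''out''}" for y using 2(2)[of y] that by simp
          then show ?case
            by (intro reach_Assign)
              (use 2(1) \<open>M2 ''p'' 0 = _ \<and> _\<close> I in
                \<open>simp add: upd_apply frame2 frame1 output_list_def\<close>)
        qed
      qed
    qed (use assms I \<open>k < ?m\<close> in \<open>simp_all add: frame\<close>)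
  qed
  then show ?thesis by (rule reach_mono) (simp_all add: separator_def Let_def)
qed

definition program_time :: "nat \<Rightarrow> nat \<Rightarrow> nat \<Rightarrow> nat" where
  "program_time r m l = locate_time m + (bias_time r m + (colour_time r m l + select_time r m))"

text \<open>
  The program uses the whole input as the list of vertices to be coloured. This includes the sizes of
  the hyperedges, which is harmless as only the colours of vertices in hyperedges matter.
\<close>

lemma reach_separator_program:
  assumes "edge_list r es"
  shows "reach (separator_program r) (program_time r (length es) (length (encode n es)))
    (input_mem (encode n es)) (\<lambda>M'. output_list M' = separator r es (encode n es))"
proof -
  let ?M = "input_mem (encode n es)"
  have zero: "?M y = (\<lambda>_. 0)" if "y \<noteq> ''in''" for y using that by (simp add: input_mem_def)
  note bias_le = edge_list.bias_le[OF assms]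
  show ?thesis
    unfolding separator_program_def program_time_def
  proof (rule reach_Seq[OF reach_locate_edges[of ?M n es, OF refl]], goal_cases)
    case (1 M1)
    have frame1: "M1 y = ?M y" if "y \<notin> {''l'', ''e'', ''pos''}" for y
      using 1(2)[of y] that by (simp add: locate_edges_def)
    show ?case
    proof (rule reach_Seq[OF reach_find_bias[OF assms]], goal_cases)
      case (3 M2)
      have frame2: "M2 y = M1 y" if "y \<notin> {''a'', ''Z'', ''X0'', ''Y0''} \<union> banks (add_up r)" for y
        using 3(2)[of y] that by (simp add: find_bias_def)
      have st: "stored es M2" by (rule stored_cong[of _ M1]) (use 1 in \<open>simp_all add: frame2\<close>)
      show ?case
      proof (rule reach_Seq[OF reach_colour_all[OF st, where r = r and xs = "encode n es"]], goal_cases)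
        case (8 M3)
        have frame3: "M3 y = M2 y" if "y \<notin> {''col'', ''n'', ''H''} \<union> banks (measure_imbalance r)" for y
          using 8(2)[of y] that by (simp add: colour_all_def)
        have "stored es M3" by (rule stored_cong[OF st]) (simp_all add: frame3)
        then show ?case
          by (rule reach_select)
            (use 3(1) 8(1) bias_le in \<open>simp_all add: frame3 frame2 frame1 zero\<close>)
      qed (use 1(1) 3(1) bias_le in \<open>simp_all add: frame2 frame1 zero\<close>, simp add: input_mem_def)
    qed (use 1(1) in \<open>simp_all add: frame1 zero\<close>)
  qed
qed

section \<open>Running time\<close>

text \<open>The base \<open>m + 1\<close> is at least 1, so exponents can be raised freely, also for
  \<open>m = 0\<close>.\<close>

definition poly_bounded :: "(nat \<Rightarrow> nat) \<Rightarrow> bool" where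
  "poly_bounded f \<longleftrightarrow> (\<exists>C c. \<forall>m. f m \<le> C * (m + 1) ^ c)"

named_theorems poly_bounded_intros

lemma poly_bounded_const [poly_bounded_intros]: "poly_bounded (\<lambda>_. K)"
  unfolding poly_bounded_def by (rule exI[of _ K], rule exI[of _ 0]) simp

lemma poly_bounded_id [poly_bounded_intros]: "poly_bounded (\<lambda>m. m)"
  unfolding poly_bounded_def by (rule exI[of _ 1], rule exI[of _ 1]) simp

lemma poly_bounded_add [poly_bounded_intros]:
  assumes "poly_bounded f" "poly_bounded g"
  shows "poly_bounded (\<lambda>m. f m + g m)"
proof -
  obtain C c D d where f: "\<And>m. f m \<le> C * (m + 1) ^ c" and g: "\<And>m. g m \<le> D * (m + 1) ^ d"
    using assms unfolding poly_bounded_def by blast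
  have "f m + g m \<le> (C + D) * (m + 1) ^ (c + d)" for m
  proof -
    have "C * (m + 1) ^ c \<le> C * (m + 1) ^ (c + d)" "D * (m + 1) ^ d \<le> D * (m + 1) ^ (c + d)"
      by (auto intro!: mult_le_mono2 power_increasing)
    then show ?thesis using f[of m] g[of m] by (simp only: add_mult_distrib)
  qed
  then show ?thesis unfolding poly_bounded_def by blast
qed

lemma poly_bounded_mult [poly_bounded_intros]:
  assumes "poly_bounded f" "poly_bounded g"
  shows "poly_bounded (\<lambda>m. f m * g m)"
proof -
  obtain C c D d where f: "\<And>m. f m \<le> C * (m + 1) ^ c" and g: "\<And>m. g m \<le> D * (m + 1) ^ d"
    using assms unfolding poly_bounded_def by blast
  have "f m * g m \<le> (C * D) * (m + 1) ^ (c + d)" for m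
    using mult_le_mono[OF f[of m] g[of m]] by (simp only: power_add ac_simps)
  then show ?thesis unfolding poly_bounded_def by blast
qed

lemma poly_bounded_power [poly_bounded_intros]: "poly_bounded f \<Longrightarrow> poly_bounded (\<lambda>m. f m ^ r)"
  by (induction r) (simp_all add: poly_bounded_const poly_bounded_mult)

text \<open>For fixed \<open>r\<close> the input length is at most linear in the number of
  hyperedges; substituting that bound leaves a polynomial in \<open>m\<close> alone, whatever the
  number of vertices.\<close>

lemma poly_bounded_program_time: "poly_bounded (\<lambda>m. program_time r m (2 + (r + 1) * m))"
  unfolding program_time_def locate_time_def bias_time_def colour_time_def select_time_def
    imbalance_time_def add_time_def weigh_time_def
  by (intro poly_bounded_intros)

lemma length_encode_ge: "length es + 2 \<le> length (encode n es)"
  by (induction es) (auto simp: encode_def)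

lemma length_encode_le:
  "(\<And>e. e \<in> set es \<Longrightarrow> length e \<le> r) \<Longrightarrow> length (encode n es) \<le> 2 + (r + 1) * length es"
  by (induction es) (force simp: encode_def)+

lemma program_time_mono: "l \<le> l' \<Longrightarrow> program_time r m l \<le> program_time r m l'"
  unfolding program_time_def colour_time_def
  by (intro add_mono mult_le_mono order_refl)

section \<open>The sublinear error term\<close>

definition error :: "(nat \<Rightarrow> real) \<Rightarrow> nat \<Rightarrow> nat \<Rightarrow> real" where
  "error k r m = 2 * sqrt (\<bar>k m\<bar> * real r * real m) + real r + 2"

lemma error_nonneg: "0 \<le> error k r m"
  by (simp add: error_def)

text \<open>Since \<open>sqrt m \<le> m\<close> for \<open>m \<ge> 1\<close>, eventually
  \<open>\<bar>k m\<bar>\<close> is at most \<open>c' * m\<close>, which puts the radicand below the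
  square of \<open>c * m\<close>.\<close>

lemma error_smallo:
  assumes "k \<in> o(\<lambda>m. sqrt (real m))"
  shows "error k r \<in> o(\<lambda>m. real m)"
proof -
  have "(\<lambda>m. sqrt (\<bar>k m\<bar> * real r * real m)) \<in> o(\<lambda>m. real m)"
  proof (rule landau_o.smallI)
    fix c :: real assume c: "c > 0"
    \<comment> \<open>The summand 1 keeps the denominator positive for \<open>r = 0\<close>.\<close>
    define c' where "c' = c\<^sup>2 / (real r + 1)"
    have "c' > 0" unfolding c'_def using c by simp
    have "c' * real r \<le> c' * (real r + 1)" using \<open>c' > 0\<close> by simp
    then have c': "c' > 0" "c' * real r \<le> c\<^sup>2"
      using \<open>c' > 0\<close> by (simp_all add: c'_def)
    have "eventually (\<lambda>m. norm (k m) \<le> c' * norm (sqrt (real m))) sequentially"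
      using landau_o.smallD[OF assms c'(1)] .
    then show "eventually (\<lambda>m. norm (sqrt (\<bar>k m\<bar> * real r * real m)) \<le> c * norm (real m)) sequentially"
      using eventually_ge_at_top[of 1]
    proof eventually_elim
      case (elim m)
      have "sqrt (real m) \<le> real m" using elim(2) by (intro real_le_lsqrt) (auto simp: power2_eq_square)
      then have "\<bar>k m\<bar> \<le> c' * real m"
        using elim(1) c'(1) by (auto intro: order_trans[OF _ mult_left_mono])
      then have "\<bar>k m\<bar> * real r * real m \<le> (c' * real m) * real r * real m"
        by (intro mult_right_mono) auto
      also have "\<dots> = (c' * real r) * (real m)\<^sup>2" by (simp add: power2_eq_square)
      also have "\<dots> \<le> c\<^sup>2 * (real m)\<^sup>2" using c'(2) by (intro mult_right_mono) auto
      finally have "sqrt (\<bar>k m\<bar> * real r * real m) \<le> sqrt ((c * real m)\<^sup>2)"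
        by (simp add: power_mult_distrib)
      then show ?case using c by simp
    qed
  qed
  moreover have "(\<lambda>_. K) \<in> o(\<lambda>m. real m)" for K :: real
    by (rule smalloI_tendsto[OF lim_const_over_n]) (auto intro: eventually_mono[OF eventually_gt_at_top[of 0]])
  ultimately show ?thesis unfolding error_def [abs_def]
    by (intro sum_in_smallo landau_o.small.cmult_in_iff[THEN iffD2]) auto
qed

text \<open>Vertices outside \<open>V\<close> lie in no hyperedge, so the absolute value of the
  degree bound holds for every element of the type, as \<open>separator_correct\<close>
  demands.\<close>

lemma separator_bounded_hypergraph:
  assumes "edge_list r es" "r > 0" "bounded_hypergraph r (k (card E)) V E" "E = set ` set es"
    "\<Union>E \<subseteq> set xs"
  defines "R \<equiv> (\<lambda>i. set (es ! i)) ` set (separator r es xs)"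
  shows "balanced_separator V E R \<and> real (card R) \<le> (1 / 2 - eps r) * real (card E) + error k r (card E)"
proof -
  interpret edge_list r es by fact
  have "real (vdegree E v) \<le> \<bar>k (card E)\<bar>" for v
  proof (cases "v \<in> V")
    case True
    then have "real (vdegree E v) \<le> k (card E)"
      using assms(3) unfolding bounded_hypergraph_def by blast
    then show ?thesis by linarith
  next
    case False
    then have "{e \<in> E. v \<in> e} = {}"
      using assms(3) unfolding bounded_hypergraph_def hypergraph_def by blast
    then show ?thesis by (simp only: vdegree_def) simp
  qed
  then show ?thesis
    using separator_correct[of xs "\<bar>k (card E)\<bar>" V] assms(2,5) card_E
    unfolding assms(4) R_def error_def by simp
qed

lemma lists_hypergraph_edge_list:
  assumes "lists_hypergraph n es V E" "bounded_hypergraph r d V E"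
  shows "edge_list r es" "E = set ` set es" "card E = length es" "\<Union>E \<subseteq> set (encode n es)"
proof -
  show E: "E = set ` set es" using assms(1) by (simp add: lists_hypergraph_def)
  show "edge_list r es"
  proof
    fix e assume e: "e \<in> set es"
    show "distinct e" using assms(1) e by (simp add: lists_hypergraph_def)
    then have "card (set e) = length e" by (rule distinct_card)
    moreover have "card (set e) \<le> r" using assms(2) e unfolding bounded_hypergraph_def E by blast
    ultimately show "length e \<le> r" by simp
  next
    show "distinct (map set es)" using assms(1) by (simp add: lists_hypergraph_def)
  qed
  then show "card E = length es" unfolding E by (rule edge_list.card_E)
  show "\<Union>E \<subseteq> set (encode n es)" by (auto simp: E encode_def)
qed

text \<open>Carries the existence claim over to an arbitrary vertex type: any enumeration of the
  hyperedges and of their vertices will do.\<close>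

lemma hypergraph_edge_list:
  assumes "bounded_hypergraph r d V E"
  obtains es xs where "edge_list r es" "E = set ` set es" "\<Union>E \<subseteq> set xs"
proof -
  have V: "finite V" "E \<subseteq> Pow V" "\<forall>e\<in>E. card e \<le> r"
    using assms by (auto simp: bounded_hypergraph_def hypergraph_def)
  then have "finite E" by (meson finite_Pow_iff finite_subset)
  then obtain Es where Es: "set Es = E" "distinct Es" using finite_distinct_list by blast
  obtain xs where xs: "set xs = V" using finite_list[OF V(1)] by blast
  define f where "f e = (SOME l. set l = e \<and> distinct l)" for e :: "'a set"
  have f: "set (f e) = e" "distinct (f e)" if "e \<in> E" for e
  proof -
    have "finite e" using V that finite_subset by blast
    then have "\<exists>l. set l = e \<and> distinct l" by (rule finite_distinct_list)
    then have "set (f e) = e \<and> distinct (f e)" unfolding f_def by (rule someI_ex)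
    then show "set (f e) = e" "distinct (f e)" by auto
  qed
  have sets: "map set (map f Es) = Es" unfolding map_map by (rule map_idI) (simp add: Es(1) f(1))
  have "edge_list r (map f Es)"
  proof
    fix e assume "e \<in> set (map f Es)"
    then obtain d where d: "d \<in> E" "e = f d" using Es by auto
    show "distinct e" using f(2)[OF d(1)] d(2) by simp
    then have "length e = card d" using distinct_card[of e] f(1)[OF d(1)] d(2) by simp
    then show "length e \<le> r" using V(3) d(1) by simp
  next
    show "distinct (map set (map f Es))" unfolding sets by (rule Es)
  qed
  moreover have "E = set ` set (map f Es)" using arg_cong[OF sets, of set] Es(1) by (simp add: image_image)
  moreover have "\<Union>E \<subseteq> set xs" using V xs by blast
  ultimately show thesis by (rule that)
qed

text \<open>The constants are obtained before the hypergraph and hence uniform. The same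
  \<open>t\<close> and \<open>M\<close> serve all coin sequences, as the program reads no
  coins.\<close>

lemma separator_program_correct:
  assumes "r > 0"
  obtains C c :: nat where "\<And>n es V E. lists_hypergraph n es V E \<Longrightarrow> bounded_hypergraph r (k (card E)) V E \<Longrightarrow>
    \<exists>t M. (\<forall>\<omega>. exec (separator_program r) (input_mem (encode n es)) \<omega> t M \<omega>) \<and>
      outputs_separator es V E ((1 / 2 - eps r) * real (card E) + error k r (card E)) M \<and>
      t \<le> C * (card E + 1) ^ c"
proof -
  obtain C c where C: "\<And>m. program_time r m (2 + (r + 1) * m) \<le> C * (m + 1) ^ c"
    using poly_bounded_program_time[of r] unfolding poly_bounded_def by blast
  show thesis
  proof (rule that)
    fix n es V E
    assume H: "lists_hypergraph n es V E" "bounded_hypergraph r (k (card E)) V E"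
    note el = lists_hypergraph_edge_list[OF H]
    have "length (encode n es) \<le> 2 + (r + 1) * length es"
      by (rule length_encode_le) (use edge_list.edges(2)[OF el(1)] in auto)
    then have "program_time r (length es) (length (encode n es)) \<le> C * (card E + 1) ^ c"
      unfolding el(3) using program_time_mono C order_trans by blast
    moreover obtain t M where t: "t \<le> program_time r (length es) (length (encode n es))"
      "\<forall>\<omega>. exec (separator_program r) (input_mem (encode n es)) \<omega> t M \<omega>"
      "output_list M = separator r es (encode n es)"
      using reach_separator_program[OF el(1), of n] unfolding reach_def by blast
    moreover have "outputs_separator es V E ((1 / 2 - eps r) * real (card E) + error k r (card E)) M"
      using separator_bounded_hypergraph[where k = k, OF el(1) assms H(2) el(2,4)]
      unfolding outputs_separator_def t(3) Let_def by (auto simp: separator_def Let_def)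
    ultimately show "\<exists>t M. (\<forall>\<omega>. exec (separator_program r) (input_mem (encode n es)) \<omega> t M \<omega>) \<and>
      outputs_separator es V E ((1 / 2 - eps r) * real (card E) + error k r (card E)) M \<and>
      t \<le> C * (card E + 1) ^ c" by (meson order_trans)
  qed
qed

text \<open>A run time bounded by \<open>t\<close> on every coin sequence has expectation at most
  \<open>t\<close>, because \<open>coins\<close> is a probability measure.\<close>

lemma expected_run_time_le:
  assumes "\<And>\<omega>. exec P (input_mem xs) \<omega> t M \<omega>"
  shows "expected_run_time P xs \<le> ennreal (real t)"
proof -
  interpret prob_space coins
    unfolding coins_def by (intro prob_space.prob_space_stream_space prob_space_measure_pmf)
  have "run_time P xs \<omega> \<le> ennreal (real t)" for \<omega>
    unfolding run_time_def by (rule Inf_lower) (use assms in \<open>auto simp: ennreal_of_nat_eq_real_of_nat\<close>)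
  then have "expected_run_time P xs \<le> (\<integral>\<^sup>+ \<omega>. ennreal (real t) \<partial>coins)"
    unfolding expected_run_time_def by (rule nn_integral_mono)
  then show ?thesis by (simp add: emeasure_space_1)
qed

theorem theorem3p3:
  fixes r :: nat and k :: "nat \<Rightarrow> real"
  assumes "r \<ge> 2"
    and "k \<in> o(\<lambda>m. sqrt (real m))"
  shows "\<exists>g :: nat \<Rightarrow> real. g \<in> o(\<lambda>m. real m) \<and>
    (\<forall>(V :: 'a set) E. bounded_hypergraph r (k (card E)) V E \<longrightarrow>
       (\<exists>R. balanced_separator V E R \<and>
            real (card R) \<le> (1/2 - eps r) * real (card E) + g (card E))) \<and>
    (\<exists>(P :: com) (C :: real) (c :: nat). \<forall>n es V E.
       lists_hypergraph n es V E \<and> bounded_hypergraph r (k (card E)) V E \<longrightarrow>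
       (\<forall>\<omega> t M \<omega>'. exec P (input_mem (encode n es)) \<omega> t M \<omega>' \<longrightarrow>
          outputs_separator es V E ((1/2 - eps r) * real (card E) + g (card E)) M) \<and>
       expected_run_time P (encode n es) \<le> ennreal (C * real (length (encode n es)) ^ c)) \<and>
    (\<exists>(P :: com) (C :: real) (c :: nat). coin_free P \<and> (\<forall>n es V E.
       lists_hypergraph n es V E \<and> bounded_hypergraph r (k (card E)) V E \<longrightarrow>
       (\<forall>\<omega>. \<exists>t M \<omega>'. exec P (input_mem (encode n es)) \<omega> t M \<omega>' \<and>
          outputs_separator es V E ((1/2 - eps r) * real (card E) + g (card E)) M \<and>
          real t \<le> C * (real (card E) + 1) ^ c *
            2 powr ((1 - 2 * (eps r)\<^sup>2) * real (card E) + g (card E)))))"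
proof -
  have r: "r > 0" using assms(1) by simp
  let ?P = "separator_program r"
  obtain C c :: nat where prog: "\<And>n es V E.
    lists_hypergraph n es V E \<Longrightarrow> bounded_hypergraph r (k (card E)) V E \<Longrightarrow>
    \<exists>t M. (\<forall>\<omega>. exec ?P (input_mem (encode n es)) \<omega> t M \<omega>) \<and>
      outputs_separator es V E ((1 / 2 - eps r) * real (card E) + error k r (card E)) M \<and>
      t \<le> C * (card E + 1) ^ c"
    by (rule separator_program_correct[OF r, of k]) blast
  have random: "(\<forall>\<omega> t M \<omega>'. exec ?P (input_mem (encode n es)) \<omega> t M \<omega>' \<longrightarrow>
      outputs_separator es V E ((1/2 - eps r) * real (card E) + error k r (card E)) M) \<and>
    expected_run_time ?P (encode n es) \<le> ennreal (real C * real (length (encode n es)) ^ c)"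
    if H: "lists_hypergraph n es V E \<and> bounded_hypergraph r (k (card E)) V E" for n es V E
  proof -
    obtain t M where t: "\<And>\<omega>. exec ?P (input_mem (encode n es)) \<omega> t M \<omega>"
      "outputs_separator es V E ((1/2 - eps r) * real (card E) + error k r (card E)) M"
      "t \<le> C * (card E + 1) ^ c"
      using prog[of n es V E] H by blast
    have "card E + 1 \<le> length (encode n es)"
      using lists_hypergraph_edge_list(3)[OF conjunct1[OF H] conjunct2[OF H]] length_encode_ge[of es n]
      by simp
    then have "t \<le> C * length (encode n es) ^ c"
      using t(3) by (meson mult_le_mono2 order_trans power_mono zero_le)
    then have "real t \<le> real C * real (length (encode n es)) ^ c"
      by (metis of_nat_le_iff of_nat_mult of_nat_power)
    then have "expected_run_time ?P (encode n es) \<le> ennreal (real C * real (length (encode n es)) ^ c)"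
      using expected_run_time_le[OF t(1)] by (meson ennreal_leI order_trans)
    \<comment> \<open>Determinism turns the one known run into a statement about all runs.\<close>
    then show ?thesis using exec_deterministic[OF t(1)] t(2) by blast
  qed
  have deterministic: "\<exists>t M \<omega>'. exec ?P (input_mem (encode n es)) \<omega> t M \<omega>' \<and>
      outputs_separator es V E ((1/2 - eps r) * real (card E) + error k r (card E)) M \<and>
      real t \<le> real C * (real (card E) + 1) ^ c *
        2 powr ((1 - 2 * (eps r)\<^sup>2) * real (card E) + error k r (card E))"
    if H: "lists_hypergraph n es V E \<and> bounded_hypergraph r (k (card E)) V E" for n es V E \<omega>
  proof -
    obtain t M where t: "\<And>\<omega>. exec ?P (input_mem (encode n es)) \<omega> t M \<omega>"
      "outputs_separator es V E ((1/2 - eps r) * real (card E) + error k r (card E)) M"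
      "t \<le> C * (card E + 1) ^ c"
      using prog[of n es V E] H by blast
    \<comment> \<open>The exponent is nonnegative, so the power of 2 is at least 1 and the
      polynomial bound implies the claimed one.\<close>
    have "(eps r)\<^sup>2 \<le> (1 / 2)\<^sup>2" using eps_nonneg eps_le_half[OF r] by (intro power_mono)
    then have "0 \<le> (1 - 2 * (eps r)\<^sup>2) * real (card E) + error k r (card E)"
      using error_nonneg by (intro add_nonneg_nonneg mult_nonneg_nonneg) (auto simp: power2_eq_square)
    then have "1 \<le> 2 powr ((1 - 2 * (eps r)\<^sup>2) * real (card E) + error k r (card E))"
      by (intro ge_one_powr_ge_zero) auto
    then have "real C * (real (card E) + 1) ^ c * 1 \<le> real C * (real (card E) + 1) ^ c *
        2 powr ((1 - 2 * (eps r)\<^sup>2) * real (card E) + error k r (card E))"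
      by (intro mult_left_mono) auto
    moreover have "real t \<le> real (C * (card E + 1) ^ c)" using t(3) by (rule of_nat_mono)
    ultimately show ?thesis using t(1,2) by (force simp: add.commute)
  qed
  have exist: "\<exists>R. balanced_separator V E R \<and>
      real (card R) \<le> (1/2 - eps r) * real (card E) + error k r (card E)"
    if H: "bounded_hypergraph r (k (card E)) V E" for V :: "'a set" and E
  proof -
    obtain es xs where "edge_list r es" "E = set ` set es" "\<Union>E \<subseteq> set xs"
      using hypergraph_edge_list[OF H] by blast
    then show ?thesis using separator_bounded_hypergraph[where k = k, OF _ r H] by blast
  qed
  show ?thesis
    using error_smallo[OF assms(2)] random deterministic exist coin_free_separator_program
    by (intro exI[of _ "error k r"] conjI exI[of _ ?P] exI[of _ "real C"] exI[of _ c]) blast+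
qed

end
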